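(* Let $G$ be a just infinite profinite group. (i) Let $\mathcal{F}$ be a class of non-abelian finite groups, and let $\mathcal{A}$ be the class of groups $A$ satisfying $\mathrm{Inn}(F)\le A\le\mathrm{Aut}(F)$ for some $F\in\mathcal{F}$. Suppose there are infinitely many pairs $(M,N)$ of normal subgroups of $G$ such that $N\le M$ and $M/N\in\mathcal{F}$. Then either $G$ is residually-$\mathcal{A}$, or it has an open normal subgroup that is residually-$\mathcal{F}$. In particular, at least one of $\mathcal{A}$ and $\mathcal{F}$ contains groups of arbitrarily large $\Phi^\lhd$-height, and hence $\mathcal{F}$ must contain infinitely many isomorphism classes. (ii) Suppose $G$ is not virtually abelian, and let $H$ be a proper open normal subgroup of $G$. Then $G$ has only finitely many normal subgroups $K$ such that $K/\Phi^\lhd(K')\cong H/\Phi^\lhd(H')$. In particular, $G$ has only finitely many normal subgroups that are isomorphic to $H$.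
   Context: All subgroups are closed (in particular the derived subgroup $H'$ means the closed derived subgroup), homomorphisms are continuous, and classes of groups are closed under isomorphism. A profinite group is just infinite if it is infinite and every non-trivial normal subgroup has finite index. For a class $\mathcal{X}$ of finite groups, the $\mathcal{X}$-residual $O^{\mathcal{X}}(G)$ of a profinite group $G$ is the intersection of all open normal subgroups $N$ with $G/N\in\mathcal{X}$; $G$ is residually-$\mathcal{X}$ if $O^{\mathcal{X}}(G)=1$. The normal Frattini subgroup $\Phi^\lhd(G)$ of a profinite group $G$ is the intersection of all maximal closed normal subgroups of $G$, equivalently the intersection of the open normal subgroups $N$ such that $G/N$ is simple (with $\Phi^\lhd(1)=1$). Put $\Phi^{\lhd 0}(G)=G$ and $\Phi^{\lhd(n+1)}(G)=\Phi^\lhd(\Phi^{\lhd n}(G))$. The $\Phi^\lhd$-height of a finite group $G$ is the least $n$ such that $\Phi^{\lhd n}(G)=1$. *)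

theory Defs
  imports "HOL-Analysis.Analysis" "HOL-Algebra.Bij" "HOL-Algebra.Generated_Groups"
begin

section \<open>Profinite groups\<close>

locale topological_group = group G
  for G :: "('a, 'b) monoid_scheme" (structure) and T :: "'a topology" +
  assumes topspace_eq: "topspace T = carrier G"
    and continuous_mult: "continuous_map (prod_topology T T) T (\<lambda>(x, y). x \<otimes> y)"
    and continuous_inv: "continuous_map T T (\<lambda>x. inv x)"

locale profinite_group = topological_group +
  assumes compact: "compact_space T"
    and Hausdorff: "Hausdorff_space T"
    and totally_disconnected: "connectedin T S \<Longrightarrow> \<exists>x. S \<subseteq> {x}"

definition closed_normal :: "('a, 'b) monoid_scheme \<Rightarrow> 'a topology \<Rightarrow> 'a set \<Rightarrow> bool" where
  "closed_normal G T N \<longleftrightarrow> N \<lhd> G \<and> closedin T N"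

definition open_normal :: "('a, 'b) monoid_scheme \<Rightarrow> 'a topology \<Rightarrow> 'a set \<Rightarrow> bool" where
  "open_normal G T N \<longleftrightarrow> N \<lhd> G \<and> openin T N"

definition just_infinite :: "('a, 'b) monoid_scheme \<Rightarrow> 'a topology \<Rightarrow> bool" where
  "just_infinite G T \<longleftrightarrow> infinite (carrier G) \<and>
     (\<forall>N. closed_normal G T N \<and> N \<noteq> {\<one>\<^bsub>G\<^esub>} \<longrightarrow> finite (rcosets\<^bsub>G\<^esub> N))"

definition virtually_abelian :: "('a, 'b) monoid_scheme \<Rightarrow> 'a topology \<Rightarrow> bool" where
  "virtually_abelian G T \<longleftrightarrow>
     (\<exists>A. subgroup A G \<and> closedin T A \<and> finite (rcosets\<^bsub>G\<^esub> A) \<and> comm_group (G\<lparr>carrier := A\<rparr>))"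

definition closed_derived :: "('a, 'b) monoid_scheme \<Rightarrow> 'a topology \<Rightarrow> 'a set \<Rightarrow> 'a set" where
  "closed_derived G T H = T closure_of (derived G H)"

definition quotient_topology ::
  "('a, 'b) monoid_scheme \<Rightarrow> 'a topology \<Rightarrow> 'a set \<Rightarrow> 'a set topology" where
  "quotient_topology G T N =
     topology (\<lambda>U. U \<subseteq> carrier (G Mod N) \<and> openin T {x \<in> carrier G. N #>\<^bsub>G\<^esub> x \<in> U})"

lemma (in topological_group) openin_quotient_topology:
  "openin (quotient_topology G T N) U \<longleftrightarrow>
     U \<subseteq> carrier (G Mod N) \<and> openin T {x \<in> carrier G. N #> x \<in> U}"
proof -
  let ?P = "\<lambda>U. {x \<in> carrier G. N #> x \<in> U}"
  have int: "?P (U \<inter> V) = ?P U \<inter> ?P V" and un: "?P (\<Union>K) = \<Union>(?P ` K)" for U V K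
    by auto
  have "istopology (\<lambda>U. U \<subseteq> carrier (G Mod N) \<and> openin T (?P U))"
    unfolding istopology_def int un by (auto intro: openin_Int openin_Union)
  then show ?thesis
    unfolding quotient_topology_def by (simp add: topology_inverse')
qed

lemma (in topological_group) quotient_map_quotient_topology:
  "quotient_map T (quotient_topology G T N) (\<lambda>x. N #> x)"
proof -
  have top: "topspace (quotient_topology G T N) = carrier (G Mod N)"
  proof -
    have "{x \<in> carrier G. N #> x \<in> carrier (G Mod N)} = topspace T"
      by (auto simp: carrier_FactGroup topspace_eq)
    then have "openin (quotient_topology G T N) (carrier (G Mod N))"
      by (simp add: openin_quotient_topology)
    then show ?thesis
      unfolding topspace_def by (auto simp: openin_quotient_topology)
  qed
  then show ?thesis
    unfolding quotient_map_def
    by (auto simp: carrier_FactGroup topspace_eq openin_quotient_topology)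
qed

definition topgroup_iso ::
  "('a, 'c) monoid_scheme \<Rightarrow> 'a topology \<Rightarrow> ('b, 'd) monoid_scheme \<Rightarrow> 'b topology \<Rightarrow> bool" where
  "topgroup_iso G T H S \<longleftrightarrow> (\<exists>f. f \<in> iso G H \<and> homeomorphic_map T S f)"


section \<open>Classes of finite groups\<close>

text \<open>Every finite group is isomorphic to a group whose elements are natural numbers, so a class
  of finite groups is represented by an isomorphism-closed set of such groups; a group over any
  other type belongs to the class if it is isomorphic to one of these.\<close>

definition finite_group_class :: "nat monoid set \<Rightarrow> bool" where
  "finite_group_class \<C> \<longleftrightarrow>
     (\<forall>X\<in>\<C>. group X \<and> finite (carrier X)) \<and>
     (\<forall>X\<in>\<C>. \<forall>Y. group Y \<and> X \<cong> Y \<longrightarrow> Y \<in> \<C>)"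

definition in_class :: "('a, 'b) monoid_scheme \<Rightarrow> nat monoid set \<Rightarrow> bool" where
  "in_class G \<C> \<longleftrightarrow> (\<exists>X\<in>\<C>. G \<cong> X)"

text \<open>The intersection with the carrier covers the case where no open normal subgroup qualifies:
  the residual is then the whole group.\<close>

definition residual ::
  "nat monoid set \<Rightarrow> ('a, 'b) monoid_scheme \<Rightarrow> 'a topology \<Rightarrow> 'a set" where
  "residual \<C> G T = carrier G \<inter> \<Inter>{N. open_normal G T N \<and> in_class (G Mod N) \<C>}"

definition residually ::
  "nat monoid set \<Rightarrow> ('a, 'b) monoid_scheme \<Rightarrow> 'a topology \<Rightarrow> bool" where
  "residually \<C> G T \<longleftrightarrow> residual \<C> G T = {\<one>\<^bsub>G\<^esub>}"

text \<open>Automorphisms in \<open>AutoGroup\<close> are extensional functions, hence the restricted abstraction.\<close>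

definition Inn :: "('a, 'b) monoid_scheme \<Rightarrow> ('a \<Rightarrow> 'a) set" where
  "Inn G = (\<lambda>g. \<lambda>x\<in>carrier G. g \<otimes>\<^bsub>G\<^esub> x \<otimes>\<^bsub>G\<^esub> inv\<^bsub>G\<^esub> g) ` carrier G"

definition between_Inn_Aut :: "nat monoid set \<Rightarrow> nat monoid set" where
  "between_Inn_Aut \<F> =
     {A. group A \<and> (\<exists>F\<in>\<F>. \<exists>B. subgroup B (AutoGroup F) \<and> Inn F \<subseteq> B \<and>
                            A \<cong> (AutoGroup F)\<lparr>carrier := B\<rparr>)}"


section \<open>The normal Frattini subgroup and height\<close>

definition maximal_closed_normal ::
  "('a, 'b) monoid_scheme \<Rightarrow> 'a topology \<Rightarrow> 'a set \<Rightarrow> bool" where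
  "maximal_closed_normal G T N \<longleftrightarrow> closed_normal G T N \<and> N \<noteq> carrier G \<and>
     (\<forall>M. closed_normal G T M \<and> N \<subseteq> M \<longrightarrow> M = N \<or> M = carrier G)"

definition normal_Frattini :: "('a, 'b) monoid_scheme \<Rightarrow> 'a topology \<Rightarrow> 'a set" where
  "normal_Frattini G T = carrier G \<inter> \<Inter>{N. maximal_closed_normal G T N}"

abbreviation normal_Frattini_of ::
  "('a, 'b) monoid_scheme \<Rightarrow> 'a topology \<Rightarrow> 'a set \<Rightarrow> 'a set" where
  "normal_Frattini_of G T H \<equiv> normal_Frattini (G\<lparr>carrier := H\<rparr>) (subtopology T H)"

definition normal_Frattini_iter ::
  "('a, 'b) monoid_scheme \<Rightarrow> 'a topology \<Rightarrow> nat \<Rightarrow> 'a set" where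
  "normal_Frattini_iter G T n = (normal_Frattini_of G T ^^ n) (carrier G)"

text \<open>Meant for finite groups, which carry the discrete topology; there the iterated normal
  Frattini subgroups decrease strictly until they are trivial, so the minimum exists.\<close>

definition Frattini_height :: "('a, 'b) monoid_scheme \<Rightarrow> nat" where
  "Frattini_height G =
     (LEAST n. normal_Frattini_iter G (discrete_topology (carrier G)) n = {\<one>\<^bsub>G\<^esub>})"

definition unbounded_height :: "nat monoid set \<Rightarrow> bool" where
  "unbounded_height \<C> \<longleftrightarrow> (\<forall>n. \<exists>X\<in>\<C>. n \<le> Frattini_height X)"

definition iso_classes :: "nat monoid set \<Rightarrow> nat monoid set set" where
  "iso_classes \<C> = \<C> // {(X, Y) \<in> \<C> \<times> \<C>. X \<cong> Y}"

text \<open>The group \<open>K / \<Phi>(K')\<close>, where \<open>\<Phi>\<close> is the normal Frattini subgroup and \<open>K'\<close> the closed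
  derived subgroup of the closed subgroup \<open>K\<close>, and its topology.\<close>

definition derived_Frattini_quotient ::
  "('a, 'b) monoid_scheme \<Rightarrow> 'a topology \<Rightarrow> 'a set \<Rightarrow> 'a set monoid" where
  "derived_Frattini_quotient G T K =
     G\<lparr>carrier := K\<rparr> Mod normal_Frattini_of G T (closed_derived G T K)"

definition derived_Frattini_quotient_topology ::
  "('a, 'b) monoid_scheme \<Rightarrow> 'a topology \<Rightarrow> 'a set \<Rightarrow> 'a set topology" where
  "derived_Frattini_quotient_topology G T K =
     quotient_topology (G\<lparr>carrier := K\<rparr>) (subtopology T K)
       (normal_Frattini_of G T (closed_derived G T K))"

end

theory Submission
  imports Defs "HOL-Algebra.SndIsomorphismGrp"
begin

text \<open>Write \<open>\<Phi>\<close> for the normal Frattini subgroup. The proof rests on two properties of a just infinite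
  profinite group \<open>G\<close>.

  First, \<open>\<Phi>(K)\<close> is non-trivial for every non-trivial closed normal subgroup \<open>K\<close>
  (\<open>normal_Frattini_of_nontrivial\<close>). In a profinite group with trivial \<open>\<Phi>\<close>, a minimal closed normal
  supplement of a maximal closed normal subgroup is a complement, hence a finite normal subgroup; and
  the conjugates in \<open>G\<close> of a finite normal subgroup of \<open>K\<close> generate a finite normal subgroup of \<open>G\<close>,
  which must be trivial.

  Second, for every open neighbourhood \<open>H\<close> of the identity only finitely many closed normal subgroups
  of \<open>G\<close> are not contained in \<open>H\<close> (\<open>obliquity\<close>). By compactness, if there were infinitely many, there
  would be a minimal \<open>K\<close> containing infinitely many of them. Since \<open>\<Phi>(K)\<close> is open, \<open>K\<close> has only
  finitely many maximal closed normal subgroups, and the core in \<open>G\<close> of one of them again contains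
  infinitely many.

  Consider now the sections \<open>M/N\<close> in \<open>\<F>\<close>, and the centralizer \<open>C\<close> of \<open>M/N\<close> in \<open>G\<close>. As \<open>M/N\<close> is
  non-abelian, \<open>M\<close> is not contained in \<open>C\<close>, and \<open>G/C\<close> lies between the inner and all automorphisms of
  \<open>M/N\<close>. An infinite set of closed normal subgroups intersects trivially, as \<open>G\<close> has finite index over
  any non-trivial one. So infinitely many \<open>C\<close> show that \<open>G\<close> is residually in the class of these
  groups of automorphisms; if there are finitely many \<open>C\<close>, then by obliquity there are finitely many
  \<open>M\<close>, so some \<open>M\<close> has infinitely many \<open>N\<close> and is residually-\<open>\<F>\<close>. The iterates
  \<open>\<Phi>(\<Phi>(\<dots>))\<close> of an open normal subgroup never become trivial, so if such a subgroup is residually in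
  a class of finite groups, the heights in this class are unbounded. Heights are bounded by orders,
  so \<open>\<F>\<close> is then infinite up to isomorphism.

  The second part of the theorem is an application of the first to the isomorphism class of the finite
  non-abelian group \<open>H/\<Phi>(H')\<close> and to the sections \<open>K/\<Phi>(K')\<close>; an isomorphism of \<open>K\<close> with \<open>H\<close> as
  topological groups induces one of \<open>K/\<Phi>(K')\<close> with \<open>H/\<Phi>(H')\<close>.\<close>

section \<open>Open and closed subgroups\<close>

lemma (in group) cancel_inv:
  assumes "g \<in> carrier G" "x \<in> carrier G"
  shows "inv g \<otimes> (g \<otimes> x) = x" "g \<otimes> (inv g \<otimes> x) = x"
  using assms by (simp_all add: m_assoc[symmetric])

lemma (in group) set_mult_supersets:
  assumes "subgroup A G" "subgroup B G"
  shows "A \<subseteq> A <#> B" "B \<subseteq> A <#> B"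
proof -
  have "a \<otimes> \<one> = a" if "a \<in> A" for a using that subgroup.mem_carrier[OF assms(1)] by simp
  then show "A \<subseteq> A <#> B"
    using subgroup.one_closed[OF assms(2)] unfolding set_mult_def by force
  have "\<one> \<otimes> b = b" if "b \<in> B" for b using that subgroup.mem_carrier[OF assms(2)] by simp
  then show "B \<subseteq> A <#> B"
    using subgroup.one_closed[OF assms(1)] unfolding set_mult_def by force
qed

context topological_group
begin

lemma continuous_map_mult:
  assumes "continuous_map X T f" "continuous_map X T g"
  shows "continuous_map X T (\<lambda>x. f x \<otimes> g x)"
proof -
  have "continuous_map X (prod_topology T T) (\<lambda>x. (f x, g x))"
    using assms by (simp add: continuous_map_pairedI)
  from continuous_map_compose[OF this continuous_mult] show ?thesis
    by (simp add: o_def)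
qed

lemma continuous_map_inv:
  assumes "continuous_map X T f"
  shows "continuous_map X T (\<lambda>x. inv (f x))"
  using continuous_map_compose[OF assms continuous_inv] by (simp add: o_def)

lemma continuous_map_constI: "a \<in> carrier G \<Longrightarrow> continuous_map X T (\<lambda>x. a)"
  by (simp add: topspace_eq)

lemmas continuous_intros_group =
  continuous_map_mult continuous_map_inv continuous_map_constI continuous_map_id[unfolded id_def]
  continuous_map_fst continuous_map_snd

lemma openin_preimage:
  "continuous_map T T f \<Longrightarrow> openin T U \<Longrightarrow> openin T {x \<in> carrier G. f x \<in> U}"
  using openin_continuous_map_preimage[of T T f U] by (simp add: topspace_eq)

lemma closedin_preimage:
  "continuous_map T T f \<Longrightarrow> closedin T U \<Longrightarrow> closedin T {x \<in> carrier G. f x \<in> U}"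
  using closedin_continuous_map_preimage[of T T f U] by (simp add: topspace_eq)

lemma open_subgroup_superset:
  assumes H: "subgroup H G" and N: "openin T N" "\<one> \<in> N" "N \<subseteq> H"
  shows "openin T H"
proof (subst openin_subopen, intro ballI)
  fix h assume h: "h \<in> H"
  then have hc: "h \<in> carrier G" using H subgroup.mem_carrier by metis
  let ?V = "{x \<in> carrier G. inv h \<otimes> x \<in> N}"
  have "openin T ?V"
    by (intro openin_preimage continuous_intros_group N) (use hc in auto)
  moreover have "h \<in> ?V" using hc N by simp
  moreover have "?V \<subseteq> H"
  proof
    fix x assume "x \<in> ?V"
    then have x: "x \<in> carrier G" "inv h \<otimes> x \<in> H" using N by auto
    then have "h \<otimes> (inv h \<otimes> x) \<in> H" using h H by (simp add: subgroup.m_closed)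
    then show "x \<in> H" using x hc by (simp add: m_assoc[symmetric])
  qed
  ultimately show "\<exists>V. openin T V \<and> h \<in> V \<and> V \<subseteq> H" by blast
qed

lemma rcoset_eq_preimage:
  assumes "subgroup H G" "x \<in> carrier G"
  shows "H #> x = {y \<in> carrier G. y \<otimes> inv x \<in> H}"
proof
  show "H #> x \<subseteq> {y \<in> carrier G. y \<otimes> inv x \<in> H}"
    using assms subgroup.mem_carrier[OF assms(1)] by (auto simp: r_coset_def m_assoc)
  show "{y \<in> carrier G. y \<otimes> inv x \<in> H} \<subseteq> H #> x"
  proof
    fix y assume y: "y \<in> {y \<in> carrier G. y \<otimes> inv x \<in> H}"
    then have "y = (y \<otimes> inv x) \<otimes> x" using assms by (simp add: m_assoc)
    then show "y \<in> H #> x" using y by (auto simp: r_coset_def)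
  qed
qed

lemma openin_rcoset:
  assumes "subgroup H G" "openin T H" "x \<in> carrier G"
  shows "openin T (H #> x)"
  unfolding rcoset_eq_preimage[OF assms(1,3)]
  by (intro openin_preimage continuous_intros_group) (use assms in auto)

lemma closedin_rcoset:
  assumes "subgroup H G" "closedin T H" "x \<in> carrier G"
  shows "closedin T (H #> x)"
  unfolding rcoset_eq_preimage[OF assms(1,3)]
  by (intro closedin_preimage continuous_intros_group) (use assms in auto)

lemma subgroup_eq_complement_rcosets:
  assumes "subgroup H G"
  shows "carrier G - H = \<Union>(rcosets H - {H})"
proof -
  have "\<Union>(rcosets H) = carrier G" using rcosets_part_G[OF assms] .
  moreover have "H \<in> rcosets H" using subgroup.subgroup_in_rcosets[OF assms] by auto
  then have "C \<inter> H = {}" if "C \<in> rcosets H" "C \<noteq> H" for C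
    using pairwiseD[OF rcos_disjoint[OF assms] that(1) \<open>H \<in> rcosets H\<close> that(2)]
    by (simp add: disjnt_def)
  ultimately show ?thesis by blast
qed

lemma open_subgroup_closed:
  assumes "subgroup H G" "openin T H"
  shows "closedin T H"
proof -
  have "openin T (\<Union>(rcosets H - {H}))"
    using assms by (intro openin_Union) (auto simp: RCOSETS_def openin_rcoset)
  then show ?thesis
    using subgroup_eq_complement_rcosets[OF assms(1)] subgroup.subset[OF assms(1)]
    by (simp add: closedin_def topspace_eq)
qed

lemma closed_finite_index_open:
  assumes "subgroup H G" "closedin T H" "finite (rcosets H)"
  shows "openin T H"
proof -
  have "closedin T (\<Union>(rcosets H - {H}))"
    using assms by (intro closedin_Union) (auto simp: RCOSETS_def closedin_rcoset)
  then have "closedin T (carrier G - H)"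
    using subgroup_eq_complement_rcosets[OF assms(1)] by simp
  then show ?thesis
    using subgroup.subset[OF assms(1)] by (simp add: openin_closedin topspace_eq)
qed

lemma closed_normalD:
  assumes "closed_normal G T N"
  shows "N \<lhd> G" "subgroup N G" "closedin T N" "N \<subseteq> carrier G"
  using assms normal_imp_subgroup[of N G] subgroup.subset[of N G] by (simp_all add: closed_normal_def)

lemma open_normal_mult:
  assumes V: "open_normal G T V" and W: "W \<lhd> G"
  shows "open_normal G T (V <#> W)"
proof -
  have n: "V <#> W \<lhd> G" using V W normal_subgroup_set_mult_closed by (simp add: open_normal_def)
  have "V \<subseteq> V <#> W" "\<one> \<in> V"
    using set_mult_supersets V W
    by (simp_all add: open_normal_def normal_imp_subgroup subgroup.one_closed)
  then show ?thesis
    using open_subgroup_superset[of "V <#> W" V] n V by (simp add: open_normal_def normal_imp_subgroup)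
qed

lemma open_normal_imp_closed_normal: "open_normal G T N \<Longrightarrow> closed_normal G T N"
  by (simp add: open_normal_def closed_normal_def open_subgroup_closed normal_imp_subgroup)

lemma closed_normal_carrier: "closed_normal G T (carrier G)"
  by (metis closed_normal_def closedin_topspace normal_self topspace_eq)

lemma normal_Inter:
  assumes "\<And>N. N \<in> \<N> \<Longrightarrow> N \<lhd> G" "\<N> \<noteq> {}"
  shows "\<Inter>\<N> \<lhd> G"
proof (rule normal_invI)
  show "subgroup (\<Inter>\<N>) G" using assms by (intro subgroups_Inter) (auto simp: normal_imp_subgroup)
  show "x \<otimes> h \<otimes> inv x \<in> \<Inter>\<N>" if "x \<in> carrier G" "h \<in> \<Inter>\<N>" for x h
    using assms that by (auto intro: normal.inv_op_closed2)
qed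

lemma closed_normal_Inter:
  assumes "\<And>N. N \<in> \<N> \<Longrightarrow> closed_normal G T N" "\<N> \<noteq> {}"
  shows "closed_normal G T (\<Inter>\<N>)"
  using assms unfolding closed_normal_def by (auto intro!: normal_Inter closedin_Inter)

end

section \<open>Profinite groups\<close>

context profinite_group
begin

lemma open_subgroup_finite_index:
  assumes "subgroup H G" "openin T H"
  shows "finite (rcosets H)"
proof -
  have "\<exists>\<F>. finite \<F> \<and> \<F> \<subseteq> rcosets H \<and> topspace T \<subseteq> \<Union>\<F>"
    using compact assms rcosets_part_G[OF assms(1)]
    unfolding compact_space_alt by (auto simp: RCOSETS_def openin_rcoset topspace_eq)
  then obtain \<F> where \<F>: "finite \<F>" "\<F> \<subseteq> rcosets H" "carrier G \<subseteq> \<Union>\<F>"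
    by (auto simp: topspace_eq)
  have "rcosets H \<subseteq> \<F>"
  proof
    fix C assume C: "C \<in> rcosets H"
    then obtain x where x: "x \<in> C" "x \<in> carrier G"
      using subgroup.rcosets_non_empty[OF assms(1) C] rcosets_part_G[OF assms(1)] by blast
    then obtain D where D: "D \<in> \<F>" "x \<in> D" using \<F> by blast
    then have "C = D"
      using pairwiseD[OF rcos_disjoint[OF assms(1)] C, of D] \<F>(2) x by (auto simp: disjnt_def)
    with D show "C \<in> \<F>" by simp
  qed
  then show ?thesis using \<F> finite_subset by blast
qed

text \<open>A subgroup that contains \<open>N\<close> is a union of cosets of \<open>N\<close>.\<close>
lemma finite_subgroups_above:
  assumes N: "subgroup N G" "finite (rcosets N)"
  shows "finite {K. subgroup K G \<and> N \<subseteq> K}"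
proof (rule finite_surj)
  show "finite (Pow (rcosets N))" using N by simp
  show "{K. subgroup K G \<and> N \<subseteq> K} \<subseteq> Union ` Pow (rcosets N)"
  proof safe
    fix K assume K: "subgroup K G" "N \<subseteq> K"
    have "K = \<Union>{N #> x | x. x \<in> K}"
    proof safe
      fix x assume "x \<in> K"
      then show "x \<in> \<Union>{N #> x | x. x \<in> K}"
        using rcos_self[of x N] N(1) subgroup.mem_carrier[OF K(1)] by auto
    next
      fix x y assume "x \<in> N #> y" "y \<in> K"
      then show "x \<in> K" using K by (auto simp: r_coset_def subgroup.m_closed)
    qed
    moreover have "{N #> x | x. x \<in> K} \<in> Pow (rcosets N)"
      using subgroup.mem_carrier[OF K(1)] by (auto simp: RCOSETS_def)
    ultimately show "K \<in> Union ` Pow (rcosets N)" by blast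
  qed
qed

text \<open>A closed subset of a product with a compact first factor projects to a closed set. So an open
  condition on pairs \<open>(w, x)\<close>, required for all \<open>w\<close> in a closed set, is an open condition on \<open>x\<close>.\<close>
lemma openin_forall_closed:
  assumes W: "closedin T W" and U: "openin T U"
    and f: "continuous_map (prod_topology T T) T f"
  shows "openin T {x \<in> carrier G. \<forall>w\<in>W. f (w, x) \<in> U}"
proof -
  let ?C = "{z \<in> topspace (prod_topology T T). fst z \<in> W \<and> f z \<in> carrier G - U}"
  have "closedin (prod_topology T T) ?C"
  proof -
    have "closedin T (carrier G - U)" using U by (simp add: closedin_diff topspace_eq[symmetric])
    then have "closedin (prod_topology T T) {z \<in> topspace (prod_topology T T). f z \<in> carrier G - U}"
      using closedin_continuous_map_preimage[OF f] by blast
    moreover have "closedin (prod_topology T T) {z \<in> topspace (prod_topology T T). fst z \<in> W}"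
      using closedin_continuous_map_preimage[OF continuous_map_fst W] .
    moreover have "?C = {z \<in> topspace (prod_topology T T). f z \<in> carrier G - U} \<inter>
        {z \<in> topspace (prod_topology T T). fst z \<in> W}" by blast
    ultimately show ?thesis by (simp only: closedin_Int)
  qed
  moreover have "closed_map (prod_topology T T) T snd"
    using closed_map_snd compact by blast
  ultimately have "closedin T (snd ` ?C)" by (simp add: closed_map_def)
  then have "openin T (carrier G - snd ` ?C)" by (simp add: openin_diff topspace_eq[symmetric])
  moreover have "f (w, x) \<in> carrier G" if "w \<in> carrier G" "x \<in> carrier G" for w x
    using continuous_map_image_subset_topspace[OF f] that by (auto simp: topspace_eq)
  then have "snd ` ?C = {x \<in> carrier G. \<exists>w\<in>W. f (w, x) \<notin> U}"
    using closedin_subset[OF W] by (fastforce simp: topspace_eq image_iff)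
  then have "carrier G - snd ` ?C = {x \<in> carrier G. \<forall>w\<in>W. f (w, x) \<in> U}"
    by auto
  ultimately show ?thesis by simp
qed

text \<open>In a compact Hausdorff space components and quasi-components agree, so the clopen sets around
  the identity intersect in the identity alone; by compactness finitely many of them intersect
  inside \<open>U\<close>.\<close>
lemma clopen_basis_one:
  assumes U: "openin T U" "\<one> \<in> U"
  obtains W where "openin T W" "closedin T W" "\<one> \<in> W" "W \<subseteq> U"
proof -
  have quasi: "quasi_component_of T \<one> = connected_component_of T \<one>"
    using quasi_eq_connected_components_of[of T] compact Hausdorff
    unfolding quasi_eq_connected_components_of_pointwise_alt by blast
  have comp: "connected_component_of T \<one> y \<Longrightarrow> y = \<one>" for y
  proof -
    assume "connected_component_of T \<one> y"
    then obtain S where S: "connectedin T S" "\<one> \<in> S" "y \<in> S"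
      by (auto simp: connected_component_of_def)
    with totally_disconnected[OF S(1)] show "y = \<one>" by blast
  qed
  let ?\<W> = "{W. \<one> \<in> W \<and> closedin T W \<and> openin T W}"
  let ?\<U> = "insert (carrier G - U) ?\<W>"
  have "\<Inter>?\<U> = {}"
  proof (rule ccontr)
    assume "\<Inter>?\<U> \<noteq> {}"
    then obtain y where y: "y \<in> carrier G - U" "\<forall>W. \<one> \<in> W \<and> closedin T W \<and> openin T W \<longrightarrow> y \<in> W"
      by blast
    then have "quasi_component_of T \<one> y" by (auto simp: quasi_component_of topspace_eq)
    then show False using quasi comp y U by auto
  qed
  moreover have "\<forall>C\<in>?\<U>. closedin T C"
    using U by (auto simp: closedin_diff topspace_eq[symmetric])
  ultimately obtain \<F> where \<F>: "finite \<F>" "\<F> \<subseteq> ?\<U>" "\<Inter>\<F> = {}"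
    using compact unfolding compact_space_fip by meson
  define W where "W = \<Inter>(insert (carrier G) (\<F> - {carrier G - U}))"
  have "openin T W"
    unfolding W_def using \<F>(1,2) by (intro openin_Inter) (auto simp: topspace_eq[symmetric])
  moreover have "closedin T W"
    unfolding W_def using \<F>(2) by (intro closedin_Inter) (auto simp: topspace_eq[symmetric])
  moreover have "\<one> \<in> W" using \<F> by (auto simp: W_def)
  moreover have "W \<subseteq> U" using \<F>(3) by (auto simp: W_def)
  ultimately show thesis using that by blast
qed

text \<open>The elements \<open>x\<close> with \<open>W x = W\<close> form an open subgroup inside the clopen set \<open>W\<close>; the
  elements all of whose conjugates lie in it form an open normal subgroup.\<close>
lemma open_normal_basis:
  assumes U: "openin T U" "\<one> \<in> U"
  obtains N where "open_normal G T N" "N \<subseteq> U"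
proof -
  obtain W where W: "openin T W" "closedin T W" "\<one> \<in> W" "W \<subseteq> U"
    using clopen_basis_one[OF U] .
  have Wc: "W \<subseteq> carrier G" using closedin_subset[OF W(2)] by (simp add: topspace_eq)
  define S where "S = {x \<in> carrier G. \<forall>w\<in>W. w \<otimes> x \<in> W} \<inter> {x \<in> carrier G. \<forall>w\<in>W. w \<otimes> inv x \<in> W}"
  have "openin T {x \<in> carrier G. \<forall>w\<in>W. fst (w, x) \<otimes> snd (w, x) \<in> W}"
    by (rule openin_forall_closed[OF W(2,1)]) (intro continuous_intros_group)
  moreover have "openin T {x \<in> carrier G. \<forall>w\<in>W. fst (w, x) \<otimes> inv (snd (w, x)) \<in> W}"
    by (rule openin_forall_closed[OF W(2,1)]) (intro continuous_intros_group)
  ultimately have Sopen: "openin T S" by (auto simp: S_def)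
  have SW: "S \<subseteq> W" using W(3) by (auto simp: S_def)
  have Ssub: "subgroup S G"
  proof (rule subgroupI)
    show "S \<subseteq> carrier G" by (auto simp: S_def)
    have "\<one> \<in> S" using Wc by (auto simp: S_def)
    then show "S \<noteq> {}" by blast
    show "inv a \<in> S" if "a \<in> S" for a using that by (auto simp: S_def)
    show "a \<otimes> b \<in> S" if "a \<in> S" "b \<in> S" for a b
    proof -
      have ab: "a \<in> carrier G" "b \<in> carrier G" using that by (auto simp: S_def)
      have "w \<otimes> (a \<otimes> b) \<in> W" if "w \<in> W" for w
        using that \<open>a \<in> S\<close> \<open>b \<in> S\<close> ab Wc by (auto simp: S_def m_assoc[symmetric] subset_iff)
      moreover have "w \<otimes> inv (a \<otimes> b) \<in> W" if "w \<in> W" for w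
        using that \<open>a \<in> S\<close> \<open>b \<in> S\<close> ab Wc
        by (auto simp: S_def m_assoc[symmetric] subset_iff inv_mult_group)
      ultimately show ?thesis using ab by (auto simp: S_def)
    qed
  qed
  define N where "N = {x \<in> carrier G. \<forall>g\<in>carrier G. g \<otimes> x \<otimes> inv g \<in> S}"
  have "closedin T (carrier G)" by (metis closedin_topspace topspace_eq)
  then have "openin T {x \<in> carrier G. \<forall>g\<in>carrier G. fst (g, x) \<otimes> snd (g, x) \<otimes> inv (fst (g, x)) \<in> S}"
    by (rule openin_forall_closed[OF _ Sopen]) (intro continuous_intros_group)
  then have Nopen: "openin T N" by (simp add: N_def)
  have NS: "N \<subseteq> S" by (auto simp: N_def dest!: bspec[where x = \<one>])
  have "subgroup N G"
  proof (rule subgroupI)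
    show "N \<subseteq> carrier G" by (auto simp: N_def)
    have "\<one> \<in> N" using subgroup.one_closed[OF Ssub] by (auto simp: N_def)
    then show "N \<noteq> {}" by blast
    show "inv a \<in> N" if "a \<in> N" for a
    proof -
      have a: "a \<in> carrier G" using that by (auto simp: N_def)
      have "g \<otimes> inv a \<otimes> inv g = inv (g \<otimes> a \<otimes> inv g)" if "g \<in> carrier G" for g
        using that a by (simp add: inv_mult_group m_assoc)
      then show ?thesis using that a subgroup.m_inv_closed[OF Ssub] by (auto simp: N_def)
    qed
    show "a \<otimes> b \<in> N" if "a \<in> N" "b \<in> N" for a b
    proof -
      have ab: "a \<in> carrier G" "b \<in> carrier G" using that by (auto simp: N_def)
      have "g \<otimes> (a \<otimes> b) \<otimes> inv g = (g \<otimes> a \<otimes> inv g) \<otimes> (g \<otimes> b \<otimes> inv g)" if "g \<in> carrier G" for g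
        using that ab by (simp add: m_assoc cancel_inv)
      then show ?thesis using that ab subgroup.m_closed[OF Ssub] by (auto simp: N_def)
    qed
  qed
  then have "N \<lhd> G"
  proof (rule normal_invI)
    fix x h assume x: "x \<in> carrier G" and h: "h \<in> N"
    have hc: "h \<in> carrier G" using h by (simp add: N_def)
    have "g \<otimes> (x \<otimes> h \<otimes> inv x) \<otimes> inv g = (g \<otimes> x) \<otimes> h \<otimes> inv (g \<otimes> x)" if "g \<in> carrier G" for g
      using that x hc by (simp add: m_assoc inv_mult_group)
    then show "x \<otimes> h \<otimes> inv x \<in> N" using x h hc by (simp add: N_def)
  qed
  then show thesis using that NS SW W Nopen by (auto simp: open_normal_def)
qed

lemma open_normal_separation:
  assumes U: "closed_normal G T U" and x: "x \<in> carrier G" "x \<notin> U"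
  obtains V where "open_normal G T V" "U \<subseteq> V" "x \<notin> V"
proof -
  have Un: "U \<lhd> G" "closedin T U" using U by (auto simp: closed_normal_def)
  have Uc: "U \<subseteq> carrier G" using Un normal_imp_subgroup subgroup.subset by blast
  let ?O = "{y \<in> carrier G. inv y \<otimes> x \<in> carrier G - U}"
  have "openin T ?O"
    using Un x by (intro openin_preimage continuous_intros_group) (auto simp: openin_diff topspace_eq[symmetric])
  moreover have "\<one> \<in> ?O" using x by simp
  ultimately obtain N where N: "open_normal G T N" "N \<subseteq> ?O" using open_normal_basis by blast
  have Nn: "N \<lhd> G" "openin T N" using N by (auto simp: open_normal_def)
  have "open_normal G T (N <#> U)" using open_normal_mult[OF N(1) Un(1)] .
  moreover have "U \<subseteq> N <#> U"
    using set_mult_supersets[of N U] Nn Un by (simp add: normal_imp_subgroup)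
  moreover have "x \<notin> N <#> U"
  proof
    assume "x \<in> N <#> U"
    then obtain n u where nu: "n \<in> N" "u \<in> U" "x = n \<otimes> u" by (auto simp: set_mult_def)
    then have "n \<in> carrier G" "u \<in> carrier G" using N(2) Uc by auto
    then have "inv n \<otimes> x = u" using nu(3) by (simp add: m_assoc[symmetric])
    then show False using nu N(2) by auto
  qed
  ultimately show thesis using that by blast
qed

lemma closed_subgroup_profinite:
  assumes K: "subgroup K G" "closedin T K"
  shows "profinite_group (G\<lparr>carrier := K\<rparr>) (subtopology T K)"
proof -
  interpret K: group "G\<lparr>carrier := K\<rparr>" using subgroup_imp_group[OF K(1)] .
  have Kc: "K \<subseteq> carrier G" using subgroup.subset[OF K(1)] .
  show ?thesis
  proof unfold_locales
    show "topspace (subtopology T K) = carrier (G\<lparr>carrier := K\<rparr>)"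
      using Kc by (auto simp: topspace_eq)
    have "continuous_map (subtopology (prod_topology T T) (K \<times> K)) T (\<lambda>(x, y). x \<otimes> y)"
      using continuous_mult by (rule continuous_map_from_subtopology)
    then show "continuous_map (prod_topology (subtopology T K) (subtopology T K)) (subtopology T K)
       (\<lambda>(x, y). x \<otimes>\<^bsub>G\<lparr>carrier := K\<rparr>\<^esub> y)"
      using subgroup.m_closed[OF K(1)]
      by (auto simp: continuous_map_in_subtopology subtopology_Times)
    have "continuous_map (subtopology T K) T (\<lambda>x. inv x)"
      using continuous_inv by (rule continuous_map_from_subtopology)
    then have "continuous_map (subtopology T K) (subtopology T K) (\<lambda>x. inv x)"
      using subgroup.m_inv_closed[OF K(1)] by (auto simp: continuous_map_in_subtopology)
    then show "continuous_map (subtopology T K) (subtopology T K) (m_inv (G\<lparr>carrier := K\<rparr>))"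
      by (rule continuous_map_eq) (use K(1) in \<open>auto simp: m_inv_consistent\<close>)
    show "compact_space (subtopology T K)"
      using compact K(2) closedin_compact_space compact_space_subtopology by blast
    show "Hausdorff_space (subtopology T K)" using Hausdorff Hausdorff_space_subtopology by blast
    show "\<exists>x. S \<subseteq> {x}" if "connectedin (subtopology T K) S" for S
      using that totally_disconnected by (auto simp: connectedin_subtopology)
  qed
qed

end

section \<open>The normal Frattini subgroup of a profinite group\<close>

lemma downward_Zorn:
  assumes "\<S> \<noteq> {}"
    and ch: "\<And>C. C \<noteq> {} \<Longrightarrow> subset.chain \<S> C \<Longrightarrow> \<Inter>C \<in> \<S>"
  shows "\<exists>M\<in>\<S>. \<forall>X\<in>\<S>. X \<subseteq> M \<longrightarrow> X = M"
proof -
  have "\<exists>M\<in>uminus ` \<S>. \<forall>X\<in>uminus ` \<S>. M \<subseteq> X \<longrightarrow> X = M"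
  proof (rule subset_Zorn_nonempty)
    show "uminus ` \<S> \<noteq> {}" using assms by simp
    fix C assume C: "C \<noteq> {}" "subset.chain (uminus ` \<S>) C"
    then have "subset.chain \<S> (uminus ` C)" by (auto simp: subset_chain_def)
    then have "\<Inter>(uminus ` C) \<in> \<S>" using C ch by simp
    moreover have "\<Union>C = - \<Inter>(uminus ` C)" by auto
    ultimately show "\<Union>C \<in> uminus ` \<S>" by blast
  qed
  then show ?thesis by auto
qed

lemma (in group) normal_in_subgroup_iff:
  assumes "subgroup K G"
  shows "N \<lhd> G\<lparr>carrier := K\<rparr> \<longleftrightarrow>
    subgroup N G \<and> N \<subseteq> K \<and> (\<forall>k\<in>K. \<forall>n\<in>N. k \<otimes> n \<otimes> inv k \<in> N)"
proof -
  have "subgroup N (G\<lparr>carrier := K\<rparr>) \<longleftrightarrow> subgroup N G \<and> N \<subseteq> K"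
    using incl_subgroup[OF assms] subgroup_incl[OF _ assms] subgroup.subset by fastforce
  then show ?thesis
    using group.normal_inv_iff[OF subgroup_imp_group[OF assms]] m_inv_consistent[OF assms] by auto
qed

lemma (in topological_group) closed_normal_in_subgroup_iff:
  assumes "subgroup K G" "closedin T K"
  shows "closed_normal (G\<lparr>carrier := K\<rparr>) (subtopology T K) N \<longleftrightarrow>
    subgroup N G \<and> closedin T N \<and> N \<subseteq> K \<and> (\<forall>k\<in>K. \<forall>n\<in>N. k \<otimes> n \<otimes> inv k \<in> N)"
  using assms unfolding closed_normal_def normal_in_subgroup_iff[OF assms(1)]
  by (auto simp: closedin_closed_subtopology)

text \<open>The conjugate \<open>g\<^sup>-\<^sup>1 N g\<close> of a subset \<open>N\<close>, written as a preimage so that openness and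
  closedness pass to it by continuity.\<close>
definition (in group) conj_preimage :: "'a \<Rightarrow> 'a set \<Rightarrow> 'a set" where
  "conj_preimage g N = {x \<in> carrier G. g \<otimes> x \<otimes> inv g \<in> N}"

lemma (in group) conj_preimage_inv:
  assumes "g \<in> carrier G" "N \<subseteq> carrier G"
  shows "conj_preimage (inv g) (conj_preimage g N) = N"
proof -
  have "g \<otimes> (inv g \<otimes> x \<otimes> g) \<otimes> inv g = x" if "x \<in> carrier G" for x
    using that assms(1) by (simp add: m_assoc cancel_inv)
  then show ?thesis using assms by (auto simp: conj_preimage_def)
qed

lemma (in group) conj_preimage_subgroup:
  assumes N: "subgroup N G" and g: "g \<in> carrier G"
  shows "subgroup (conj_preimage g N) G"
proof (rule subgroupI)
  show "conj_preimage g N \<subseteq> carrier G" by (auto simp: conj_preimage_def)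
  have "\<one> \<in> conj_preimage g N" using g subgroup.one_closed[OF N] by (simp add: conj_preimage_def)
  then show "conj_preimage g N \<noteq> {}" by blast
  show "inv a \<in> conj_preimage g N" if "a \<in> conj_preimage g N" for a
  proof -
    have a: "a \<in> carrier G" "g \<otimes> a \<otimes> inv g \<in> N" using that by (auto simp: conj_preimage_def)
    have "g \<otimes> inv a \<otimes> inv g = inv (g \<otimes> a \<otimes> inv g)"
      using g a by (simp add: inv_mult_group m_assoc)
    then show ?thesis using a subgroup.m_inv_closed[OF N] by (simp add: conj_preimage_def)
  qed
  show "a \<otimes> b \<in> conj_preimage g N" if "a \<in> conj_preimage g N" "b \<in> conj_preimage g N" for a b
  proof -
    have ab: "a \<in> carrier G" "g \<otimes> a \<otimes> inv g \<in> N" "b \<in> carrier G" "g \<otimes> b \<otimes> inv g \<in> N"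
      using that by (auto simp: conj_preimage_def)
    have "g \<otimes> (a \<otimes> b) \<otimes> inv g = (g \<otimes> a \<otimes> inv g) \<otimes> (g \<otimes> b \<otimes> inv g)"
      using g ab by (simp add: m_assoc cancel_inv)
    then show ?thesis using ab subgroup.m_closed[OF N] by (simp add: conj_preimage_def)
  qed
qed

lemma (in topological_group) closed_normal_conj_preimage:
  assumes K: "closed_normal G T K"
    and N: "closed_normal (G\<lparr>carrier := K\<rparr>) (subtopology T K) N"
    and g: "g \<in> carrier G"
  shows "closed_normal (G\<lparr>carrier := K\<rparr>) (subtopology T K) (conj_preimage g N)"
proof -
  note Kn = closed_normalD[OF K]
  note Kc = Kn(4)
  note cn = closed_normal_in_subgroup_iff[OF Kn(2,3)]
  have N: "subgroup N G" "closedin T N" "N \<subseteq> K" and Nk: "\<And>k n. k \<in> K \<Longrightarrow> n \<in> N \<Longrightarrow> k \<otimes> n \<otimes> inv k \<in> N"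
    using assms(2) unfolding cn by auto
  have "subgroup (conj_preimage g N) G" using conj_preimage_subgroup[OF N(1) g] .
  moreover have "closedin T (conj_preimage g N)"
    unfolding conj_preimage_def by (intro closedin_preimage continuous_intros_group N g inv_closed)
  moreover have "conj_preimage g N \<subseteq> K"
  proof
    fix x assume "x \<in> conj_preimage g N"
    then have x: "x \<in> carrier G" "g \<otimes> x \<otimes> inv g \<in> K" using N(3) by (auto simp: conj_preimage_def)
    have "inv g \<otimes> (g \<otimes> x \<otimes> inv g) \<otimes> g \<in> K"
      using normal.inv_op_closed1[OF Kn(1) g x(2)] .
    moreover have "inv g \<otimes> (g \<otimes> x \<otimes> inv g) \<otimes> g = x"
      using x(1) g by (simp add: m_assoc cancel_inv)
    ultimately show "x \<in> K" by simp
  qed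
  moreover have "k \<otimes> n \<otimes> inv k \<in> conj_preimage g N" if "k \<in> K" "n \<in> conj_preimage g N" for k n
  proof -
    have kc: "k \<in> carrier G" "n \<in> carrier G" using that Kc by (auto simp: conj_preimage_def)
    have "g \<otimes> k \<otimes> inv g \<in> K" using normal.inv_op_closed2[OF Kn(1) g that(1)] .
    then have "(g \<otimes> k \<otimes> inv g) \<otimes> (g \<otimes> n \<otimes> inv g) \<otimes> inv (g \<otimes> k \<otimes> inv g) \<in> N"
      using Nk that(2) by (simp add: conj_preimage_def)
    moreover have "(g \<otimes> k \<otimes> inv g) \<otimes> (g \<otimes> n \<otimes> inv g) \<otimes> inv (g \<otimes> k \<otimes> inv g)
        = g \<otimes> (k \<otimes> n \<otimes> inv k) \<otimes> inv g"
      using kc g by (simp add: m_assoc inv_mult_group cancel_inv)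
    ultimately show ?thesis using kc by (simp add: conj_preimage_def)
  qed
  ultimately show ?thesis unfolding cn by blast
qed

context profinite_group
begin

lemma maximal_closed_normal_open:
  assumes U: "maximal_closed_normal G T U"
  shows "open_normal G T U"
proof -
  have Uc: "closed_normal G T U" "U \<noteq> carrier G" using U by (auto simp: maximal_closed_normal_def)
  then obtain x where "x \<in> carrier G" "x \<notin> U" using closed_normalD(4)[OF Uc(1)] by blast
  then obtain V where V: "open_normal G T V" "U \<subseteq> V" "x \<notin> V"
    using open_normal_separation[OF Uc(1)] by blast
  then have "V = U"
    using U open_normal_imp_closed_normal \<open>x \<in> carrier G\<close> unfolding maximal_closed_normal_def by blast
  with V show ?thesis by simp
qed

lemma maximal_closed_normal_exists:
  assumes N: "closed_normal G T N" "N \<noteq> carrier G"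
  obtains U where "maximal_closed_normal G T U" "N \<subseteq> U"
proof -
  obtain x where x: "x \<in> carrier G" "x \<notin> N" using N closed_normalD(4)[OF N(1)] by blast
  then obtain V where V: "open_normal G T V" "N \<subseteq> V" "x \<notin> V"
    using open_normal_separation[OF N(1)] by blast
  let ?\<S> = "{K. closed_normal G T K \<and> V \<subseteq> K \<and> K \<noteq> carrier G}"
  have "finite {K. subgroup K G \<and> V \<subseteq> K}"
    using V by (intro finite_subgroups_above open_subgroup_finite_index)
      (auto simp: open_normal_def normal_imp_subgroup)
  then have fin: "finite ?\<S>"
    by (rule rev_finite_subset) (auto simp: closed_normal_def normal_imp_subgroup)
  have "V \<in> ?\<S>" using V x open_normal_imp_closed_normal by auto
  then have "?\<S> \<noteq> {}" by blast
  from finite_has_maximal[OF fin this]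
  obtain U where U: "U \<in> ?\<S>" "\<And>K. K \<in> ?\<S> \<Longrightarrow> U \<subseteq> K \<Longrightarrow> U = K" by auto
  have "maximal_closed_normal G T U"
    unfolding maximal_closed_normal_def using U(1) U(2) by fastforce
  moreover have "N \<subseteq> U" using U V by blast
  ultimately show thesis using that by blast
qed

lemma normal_Frattini_closed_normal: "closed_normal G T (normal_Frattini G T)"
proof -
  have "normal_Frattini G T = \<Inter>(insert (carrier G) {N. maximal_closed_normal G T N})"
    by (simp add: normal_Frattini_def)
  then show ?thesis
    using closed_normal_Inter[of "insert (carrier G) {N. maximal_closed_normal G T N}"]
      closed_normal_carrier by (auto simp: maximal_closed_normal_def)
qed

lemma closed_normal_one: "closed_normal G T {\<one>}"
  using one_is_normal Hausdorff by (simp add: closed_normal_def closedin_Hausdorff_singleton topspace_eq)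

lemma normal_Frattini_proper:
  assumes "carrier G \<noteq> {\<one>}"
  shows "normal_Frattini G T \<noteq> carrier G"
proof -
  obtain U where U: "maximal_closed_normal G T U"
    using maximal_closed_normal_exists[OF closed_normal_one] assms by metis
  then have "normal_Frattini G T \<subseteq> U" by (auto simp: normal_Frattini_def)
  moreover have "U \<subset> carrier G"
    using U closed_normalD(4)[of U] by (auto simp: maximal_closed_normal_def)
  ultimately show ?thesis by blast
qed

lemma chain_Inter_nonempty:
  assumes "subset.chain {C. closedin T C \<and> C \<noteq> {}} \<C>"
  shows "\<Inter>\<C> \<noteq> {}"
proof -
  have "\<Inter>\<F> \<noteq> {}" if "finite \<F>" "\<F> \<subseteq> \<C>" for \<F>
  proof (cases "\<F> = {}")
    case False
    have "subset.chain {C. closedin T C \<and> C \<noteq> {}} \<F>"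
      using assms that(2) by (meson subset_chain_def subset_iff)
    from Inter_in_chain[OF that(1) False this] this show ?thesis by (auto simp: subset_chain_def)
  qed auto
  moreover have "\<forall>C\<in>\<C>. closedin T C" using assms by (auto simp: subset_chain_def)
  ultimately show ?thesis
    using compact[unfolded compact_space_fip, THEN spec[where x = \<C>]] by simp
qed

text \<open>A maximal closed normal subgroup \<open>U\<close> has a minimal closed normal supplement \<open>L\<close>. If \<open>L \<inter> U\<close>
  were non-trivial, it would be outside some other maximal \<open>V\<close>, and then \<open>L \<inter> V\<close> would be a smaller
  supplement. So \<open>L\<close> is a complement of the open subgroup \<open>U\<close>, hence finite.\<close>
lemma finite_normal_if_trivial_normal_Frattini:
  assumes "normal_Frattini G T = {\<one>}" "carrier G \<noteq> {\<one>}"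
  obtains L where "L \<lhd> G" "finite L" "L \<noteq> {\<one>}"
proof -
  obtain U where U: "maximal_closed_normal G T U"
    using maximal_closed_normal_exists[OF closed_normal_one] assms(2) by metis
  have Uo: "open_normal G T U" using maximal_closed_normal_open[OF U] .
  have Un: "U \<lhd> G" "subgroup U G" "openin T U" "closedin T U"
    using Uo open_normal_imp_closed_normal[OF Uo]
    by (auto simp: open_normal_def closed_normal_def normal_imp_subgroup)
  \<comment> \<open>The second condition says \<open>L U = G\<close>.\<close>
  define \<S> where "\<S> = {L. closed_normal G T L \<and> (\<forall>g\<in>carrier G. \<exists>x\<in>L. inv x \<otimes> g \<in> U)}"
  have "\<exists>L\<in>\<S>. \<forall>X\<in>\<S>. X \<subseteq> L \<longrightarrow> X = L"
  proof (rule downward_Zorn)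
    have "carrier G \<in> \<S>"
      using closed_normal_carrier subgroup.one_closed[OF Un(2)]
      by (auto simp: \<S>_def intro!: bexI[where x = "_"])
    then show "\<S> \<noteq> {}" by blast
    fix C assume C: "C \<noteq> {}" "subset.chain \<S> C"
    then have CS: "\<And>L. L \<in> C \<Longrightarrow> L \<in> \<S>" by (auto simp: subset_chain_def)
    have "\<exists>x\<in>\<Inter>C. inv x \<otimes> g \<in> U" if g: "g \<in> carrier G" for g
    proof -
      define P where "P = {x \<in> carrier G. inv x \<otimes> g \<in> U}"
      have Pc: "closedin T P"
        unfolding P_def by (intro closedin_preimage continuous_intros_group Un) (rule g)
      have "subset.chain {C. closedin T C \<and> C \<noteq> {}} ((\<lambda>L. L \<inter> P) ` C)"
        unfolding subset_chain_def
      proof (intro conjI ballI subsetI)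
        fix Y assume "Y \<in> (\<lambda>L. L \<inter> P) ` C"
        then obtain L where L: "L \<in> C" "Y = L \<inter> P" by blast
        then have "closed_normal G T L" and "\<exists>x\<in>L. inv x \<otimes> g \<in> U"
          using CS g by (auto simp: \<S>_def)
        then show "Y \<in> {C. closedin T C \<and> C \<noteq> {}}"
          using Pc L(2) normal_imp_subgroup[of L] subgroup.mem_carrier[of L G]
          by (auto simp: closed_normal_def P_def)
      next
        fix Y Z assume "Y \<in> (\<lambda>L. L \<inter> P) ` C" "Z \<in> (\<lambda>L. L \<inter> P) ` C"
        then obtain L M where "L \<in> C" "Y = L \<inter> P" "M \<in> C" "Z = M \<inter> P" by blast
        moreover have "L \<subseteq> M \<or> M \<subseteq> L" using C(2) calculation by (auto simp: subset_chain_def)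
        ultimately show "Y \<subseteq> Z \<or> Z \<subseteq> Y" by blast
      qed
      from chain_Inter_nonempty[OF this] show ?thesis using C(1) by (auto simp: P_def)
    qed
    moreover have "closed_normal G T (\<Inter>C)"
      using CS C(1) by (intro closed_normal_Inter) (auto simp: \<S>_def)
    ultimately show "\<Inter>C \<in> \<S>" by (auto simp: \<S>_def)
  qed
  then obtain L where L: "L \<in> \<S>" "\<And>X. X \<in> \<S> \<Longrightarrow> X \<subseteq> L \<Longrightarrow> X = L" by blast
  have Ln: "L \<lhd> G" "subgroup L G" "closedin T L"
    using L(1) by (auto simp: \<S>_def closed_normal_def normal_imp_subgroup)
  have LU: "L \<inter> U = {\<one>}"
  proof (rule ccontr)
    assume "L \<inter> U \<noteq> {\<one>}"
    moreover have "\<one> \<in> L \<inter> U" using Ln Un subgroup.one_closed by blast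
    ultimately obtain y where y: "y \<in> L" "y \<in> U" "y \<noteq> \<one>" by blast
    moreover have "y \<in> carrier G" using y Ln subgroup.mem_carrier by metis
    ultimately obtain V where V: "maximal_closed_normal G T V" "y \<notin> V"
      using assms(1) unfolding normal_Frattini_def by blast
    have Vn: "open_normal G T V" "V \<lhd> G" "subgroup V G" "closedin T V"
      using maximal_closed_normal_open[OF V(1)] open_normal_imp_closed_normal
      by (auto simp: open_normal_def closed_normal_def normal_imp_subgroup)
    have LUn: "L \<inter> U \<lhd> G" using normal_subgroup_intersect[OF Ln(1) Un(1)] .
    have VLU: "V <#> (L \<inter> U) = carrier G"
    proof -
      have "closed_normal G T (V <#> (L \<inter> U))"
        using open_normal_imp_closed_normal[OF open_normal_mult[OF Vn(1) LUn]] .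
      moreover have "V \<subseteq> V <#> (L \<inter> U)" "L \<inter> U \<subseteq> V <#> (L \<inter> U)"
        using set_mult_supersets[OF Vn(3) normal_imp_subgroup[OF LUn]] by auto
      ultimately show ?thesis using V y unfolding maximal_closed_normal_def by blast
    qed
    have "L \<inter> V \<in> \<S>"
    proof -
      have "\<exists>v\<in>L \<inter> V. inv v \<otimes> g \<in> U" if g: "g \<in> carrier G" for g
      proof -
        obtain x where x: "x \<in> L" "inv x \<otimes> g \<in> U" using L(1) g by (auto simp: \<S>_def)
        then have xc: "x \<in> carrier G" using Ln subgroup.mem_carrier by metis
        then obtain v w where vw: "v \<in> V" "w \<in> L" "w \<in> U" "x = v \<otimes> w"
          using VLU unfolding set_mult_def by blast
        have c: "v \<in> carrier G" "w \<in> carrier G"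
          using vw subgroup.mem_carrier[OF Vn(3)] subgroup.mem_carrier[OF Ln(2)] by auto
        then have "v = x \<otimes> inv w" using vw(4) by (simp add: m_assoc)
        then have "v \<in> L" using x(1) vw(2) Ln(2) by (simp add: subgroup.m_closed subgroup.m_inv_closed)
        moreover have "inv v \<otimes> g = w \<otimes> (inv x \<otimes> g)"
          using c g vw(4) by (simp add: inv_mult_group m_assoc[symmetric])
        then have "inv v \<otimes> g \<in> U" using x(2) vw(3) Un(2) by (simp add: subgroup.m_closed)
        ultimately show ?thesis using vw(1) by blast
      qed
      then show ?thesis
        using normal_subgroup_intersect[OF Ln(1) Vn(2)] Ln(3) Vn(4)
        by (auto simp: \<S>_def closed_normal_def)
    qed
    then have "L \<inter> V = L" using L(2) by blast
    then show False using y(1) V(2) by blast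
  qed
  have "inj_on (\<lambda>x. U #> x) L"
  proof (rule inj_onI)
    fix x y assume xy: "x \<in> L" "y \<in> L" "U #> x = U #> y"
    have c: "x \<in> carrier G" "y \<in> carrier G" using xy subgroup.mem_carrier[OF Ln(2)] by auto
    have "x \<in> U #> y" using rcos_self[OF c(1) Un(2)] xy(3) by simp
    then have "x \<otimes> inv y \<in> U" by (simp add: rcoset_eq_preimage[OF Un(2) c(2)])
    moreover have "x \<otimes> inv y \<in> L" using xy Ln(2) by (simp add: subgroup.m_closed subgroup.m_inv_closed)
    ultimately have "x \<otimes> inv y = \<one>" using LU by blast
    then show "x = y" using c by (metis inv_equality inv_inv inv_closed)
  qed
  moreover have "(\<lambda>x. U #> x) ` L \<subseteq> rcosets U"
    using subgroup.mem_carrier[OF Ln(2)] by (auto simp: RCOSETS_def)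
  moreover have "finite (rcosets U)" using open_subgroup_finite_index Un by blast
  ultimately have "finite L" by (meson finite_imageD finite_subset)
  moreover have "L \<noteq> {\<one>}"
  proof
    assume "L = {\<one>}"
    then have "carrier G \<subseteq> U" using L(1) by (auto simp: \<S>_def)
    then show False
      using U subgroup.subset[OF Un(2)] by (auto simp: maximal_closed_normal_def)
  qed
  ultimately show thesis using that Ln(1) by blast
qed

text \<open>Conjugation by elements of the whole group permutes the maximal closed normal subgroups of
  a normal subgroup.\<close>
lemma normal_Frattini_of_closed_normal:
  assumes K: "closed_normal G T K"
  shows "closed_normal G T (normal_Frattini_of G T K)"
    and "normal_Frattini_of G T K \<subseteq> K"
proof -
  have Kn: "K \<lhd> G" "subgroup K G" "closedin T K"
    using K by (auto simp: closed_normal_def normal_imp_subgroup)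
  have Kc: "K \<subseteq> carrier G" using subgroup.subset[OF Kn(2)] .
  interpret K: profinite_group "G\<lparr>carrier := K\<rparr>" "subtopology T K"
    using closed_subgroup_profinite Kn by blast
  note cn = closed_normal_in_subgroup_iff[OF Kn(2,3)]
  let ?cn = "closed_normal (G\<lparr>carrier := K\<rparr>) (subtopology T K)"
  let ?max = "maximal_closed_normal (G\<lparr>carrier := K\<rparr>) (subtopology T K)"
  have cn_conj: "?cn (conj_preimage g N)" if "?cn N" "g \<in> carrier G" for g N
    using closed_normal_conj_preimage[OF K that] .
  have cnc: "N \<subseteq> carrier G" if "?cn N" for N using that unfolding cn using Kc by blast
  have conj_K: "conj_preimage g K = K" if "g \<in> carrier G" for g
  proof -
    have *: "conj_preimage h K \<subseteq> K" if "h \<in> carrier G" for h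
      using cn_conj[OF _ that] K.closed_normal_carrier by (simp add: cn)
    have "conj_preimage (inv g) K \<subseteq> K" using * that by simp
    then have "conj_preimage g (conj_preimage (inv g) K) \<subseteq> conj_preimage g K" by (auto simp: conj_preimage_def)
    then show ?thesis using *[OF that] conj_preimage_inv[of "inv g" K] that Kc by simp
  qed
  have max_conj: "?max (conj_preimage g N)" if N: "?max N" and g: "g \<in> carrier G" for g N
    unfolding maximal_closed_normal_def
  proof (intro conjI allI impI)
    have Nc: "?cn N" "N \<noteq> K" using N by (auto simp: maximal_closed_normal_def)
    show "?cn (conj_preimage g N)" using cn_conj Nc g by blast
    show "conj_preimage g N \<noteq> carrier (G\<lparr>carrier := K\<rparr>)"
    proof
      assume "conj_preimage g N = carrier (G\<lparr>carrier := K\<rparr>)"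
      then have "conj_preimage (inv g) (conj_preimage g N) = K" using conj_K g by simp
      then show False using conj_preimage_inv[OF g cnc[OF Nc(1)]] Nc(2) by simp
    qed
    fix M assume M: "?cn M \<and> conj_preimage g N \<subseteq> M"
    then have "conj_preimage (inv g) (conj_preimage g N) \<subseteq> conj_preimage (inv g) M" by (auto simp: conj_preimage_def)
    then have "N \<subseteq> conj_preimage (inv g) M" using conj_preimage_inv[OF g cnc[OF Nc(1)]] by simp
    moreover have "?cn (conj_preimage (inv g) M)" using cn_conj M g by simp
    ultimately have "conj_preimage (inv g) M = N \<or> conj_preimage (inv g) M = K"
      using N by (auto simp: maximal_closed_normal_def)
    moreover have "conj_preimage g (conj_preimage (inv g) M) = M"
      using conj_preimage_inv[of "inv g" M] cnc M g by simp
    ultimately show "M = conj_preimage g N \<or> M = carrier (G\<lparr>carrier := K\<rparr>)"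
      using conj_K[OF g] by auto
  qed
  have P: "?cn (normal_Frattini_of G T K)" using K.normal_Frattini_closed_normal .
  have "x \<otimes> h \<otimes> inv x \<in> normal_Frattini_of G T K"
    if x: "x \<in> carrier G" and h: "h \<in> normal_Frattini_of G T K" for x h
    unfolding normal_Frattini_def
  proof (intro IntI InterI)
    have "h \<in> K" using h by (simp add: normal_Frattini_def)
    then show "x \<otimes> h \<otimes> inv x \<in> carrier (G\<lparr>carrier := K\<rparr>)"
      using normal.inv_op_closed2[OF Kn(1) x] by simp
    fix N assume "N \<in> {N. ?max N}"
    then have "?max (conj_preimage x N)" using max_conj x by blast
    then have "h \<in> conj_preimage x N" using h by (simp add: normal_Frattini_def)
    then show "x \<otimes> h \<otimes> inv x \<in> N" by (simp add: conj_preimage_def)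
  qed
  then have "normal_Frattini_of G T K \<lhd> G"
    using P[unfolded cn] by (intro normal_invI) auto
  then show "closed_normal G T (normal_Frattini_of G T K)"
    using P[unfolded cn] by (simp add: closed_normal_def)
  show "normal_Frattini_of G T K \<subseteq> K" using P unfolding cn by blast
qed

end

section \<open>Just infinite profinite groups\<close>

text \<open>The product of finitely many finite normal subgroups is a finite normal subgroup.\<close>
lemma (in group) finite_normal_cover:
  assumes "finite \<L>" "\<And>L. L \<in> \<L> \<Longrightarrow> L \<lhd> G" "\<And>L. L \<in> \<L> \<Longrightarrow> finite L"
  shows "\<exists>M. M \<lhd> G \<and> finite M \<and> \<Union>\<L> \<subseteq> M"
  using assms
proof (induction \<L> rule: finite_induct)
  case empty
  show ?case by (rule exI[where x = "{\<one>}"]) (simp add: one_is_normal)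
next
  case (insert L \<L>)
  have "\<exists>M. M \<lhd> G \<and> finite M \<and> \<Union>\<L> \<subseteq> M" by (rule insert.IH) (simp_all add: insert.prems)
  then obtain M where M: "M \<lhd> G" "finite M" "\<Union>\<L> \<subseteq> M" by (elim exE conjE)
  have L: "L \<lhd> G" "finite L" by (simp_all add: insert.prems)
  have "L \<subseteq> L <#> M" "M \<subseteq> L <#> M"
    using set_mult_supersets[OF normal_imp_subgroup[OF L(1)] normal_imp_subgroup[OF M(1)]] .
  moreover have "finite (L <#> M)" using L M by (simp add: set_mult_def)
  moreover have "L <#> M \<lhd> G" using normal_subgroup_set_mult_closed L M by blast
  ultimately show ?case using M(3) by (intro exI[of _ "L <#> M"]) auto
qed

locale just_infinite_profinite_group = profinite_group +
  assumes just_infinite: "just_infinite G T"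
begin

lemma infinite_carrier: "infinite (carrier G)"
  using just_infinite by (simp add: just_infinite_def)

lemma open_normal_if_nontrivial:
  assumes "closed_normal G T N" "N \<noteq> {\<one>}"
  shows "open_normal G T N"
  using assms just_infinite closed_normalD[OF assms(1)]
  by (simp add: just_infinite_def open_normal_def closed_finite_index_open)

lemma finite_normal_trivial:
  assumes "L \<lhd> G" "finite L"
  shows "L = {\<one>}"
proof (rule ccontr)
  assume "L \<noteq> {\<one>}"
  have L: "subgroup L G" "L \<subseteq> carrier G" using assms normal_imp_subgroup subgroup.subset by blast+
  then have "closedin T L"
    using closedin_Hausdorff_finite[OF Hausdorff] assms by (simp add: topspace_eq)
  then have "finite (rcosets L)"
    using \<open>L \<noteq> {\<one>}\<close> assms just_infinite by (simp add: just_infinite_def closed_normal_def)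
  moreover have "finite C" if "C \<in> rcosets L" for C using rcosets_finite[OF that L(2) assms(2)] .
  ultimately have "finite (\<Union>(rcosets L))" by blast
  then show False using infinite_carrier rcosets_part_G[OF L(1)] by simp
qed

lemma finite_closed_normals_above:
  assumes "closed_normal G T N" "N \<noteq> {\<one>}"
  shows "finite {K. closed_normal G T K \<and> N \<subseteq> K}"
proof -
  have "finite {K. subgroup K G \<and> N \<subseteq> K}"
    using open_normal_if_nontrivial[OF assms] closed_normalD[OF assms(1)]
    by (intro finite_subgroups_above open_subgroup_finite_index) (auto simp: open_normal_def)
  then show ?thesis by (rule rev_finite_subset) (auto dest: closed_normalD)
qed

lemma infinite_closed_normals_Inter:
  assumes "infinite \<N>" "\<And>N. N \<in> \<N> \<Longrightarrow> closed_normal G T N"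
  shows "\<Inter>\<N> = {\<one>}"
proof (rule ccontr)
  assume ne: "\<Inter>\<N> \<noteq> {\<one>}"
  have "\<N> \<noteq> {}" using assms(1) by auto
  then have "closed_normal G T (\<Inter>\<N>)" using assms(2) by (intro closed_normal_Inter)
  from finite_closed_normals_above[OF this ne] have "finite \<N>"
    by (rule rev_finite_subset) (use assms(2) in blast)
  then show False using assms(1) by simp
qed

text \<open>If it were trivial, \<open>K\<close> would have a finite non-trivial normal subgroup. This has only finitely many conjugates
  in \<open>G\<close>, since \<open>K\<close> has finite index; together they generate a finite normal subgroup of \<open>G\<close>.\<close>
lemma normal_Frattini_of_nontrivial:
  assumes K: "closed_normal G T K" "K \<noteq> {\<one>}"
  shows "normal_Frattini_of G T K \<noteq> {\<one>}"
proof
  assume triv: "normal_Frattini_of G T K = {\<one>}"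
  note Kn = closed_normalD[OF K(1)]
  note cn = closed_normal_in_subgroup_iff[OF Kn(2,3)]
  interpret K: profinite_group "G\<lparr>carrier := K\<rparr>" "subtopology T K"
    using closed_subgroup_profinite Kn by blast
  obtain L where L: "L \<lhd> G\<lparr>carrier := K\<rparr>" "finite L" "L \<noteq> {\<one>}"
    using K.finite_normal_if_trivial_normal_Frattini triv K(2) by auto
  have Ln: "subgroup L G" "L \<subseteq> K" and Lk: "\<And>k n. k \<in> K \<Longrightarrow> n \<in> L \<Longrightarrow> k \<otimes> n \<otimes> inv k \<in> L"
    using L(1) unfolding normal_in_subgroup_iff[OF Kn(2)] by auto
  have Lc: "L \<subseteq> carrier G" using Ln(2) Kn(4) by blast
  have "closedin T L" using closedin_Hausdorff_finite[OF Hausdorff] L(2) Lc by (simp add: topspace_eq)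
  then have Lcn: "closed_normal (G\<lparr>carrier := K\<rparr>) (subtopology T K) L"
    unfolding cn using Ln Lk by blast
  define \<L> where "\<L> = (\<lambda>g. conj_preimage g L) ` carrier G"
  have coset: "conj_preimage (k \<otimes> x) L = conj_preimage x L" if k: "k \<in> K" and x: "x \<in> carrier G" for k x
  proof -
    have kc: "k \<in> carrier G" using k Kn(4) by blast
    have eq: "k \<otimes> x \<otimes> y \<otimes> inv (k \<otimes> x) = k \<otimes> (x \<otimes> y \<otimes> inv x) \<otimes> inv k" if "y \<in> carrier G" for y
      using that kc x by (simp add: m_assoc inv_mult_group)
    have "z \<in> L \<longleftrightarrow> k \<otimes> z \<otimes> inv k \<in> L" if z: "z \<in> carrier G" for z
    proof
      assume "k \<otimes> z \<otimes> inv k \<in> L"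
      then have "inv k \<otimes> (k \<otimes> z \<otimes> inv k) \<otimes> inv (inv k) \<in> L"
        using Lk[of "inv k"] k Kn(2) by (simp add: subgroup.m_inv_closed)
      then show "z \<in> L" using kc z by (simp add: m_assoc cancel_inv)
    qed (use Lk k in blast)
    then show ?thesis using x kc by (auto simp: conj_preimage_def eq)
  qed
  have "finite (rcosets K)"
    using just_infinite K by (simp add: just_infinite_def)
  moreover have "\<L> \<subseteq> (\<lambda>C. conj_preimage (SOME x. x \<in> C) L) ` (rcosets K)"
  proof
    fix Y assume "Y \<in> \<L>"
    then obtain x where x: "x \<in> carrier G" "Y = conj_preimage x L" by (auto simp: \<L>_def)
    have "x \<in> K #> x" using rcos_self[OF x(1) Kn(2)] .
    then have "(SOME y. y \<in> K #> x) \<in> K #> x" by (rule someI)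
    then obtain k where "k \<in> K" "(SOME y. y \<in> K #> x) = k \<otimes> x" by (auto simp: r_coset_def)
    then have "conj_preimage (SOME y. y \<in> K #> x) L = Y" using coset x by simp
    moreover have "K #> x \<in> rcosets K" using x(1) by (auto simp: RCOSETS_def)
    ultimately show "Y \<in> (\<lambda>C. conj_preimage (SOME x. x \<in> C) L) ` (rcosets K)" by blast
  qed
  ultimately have fin: "finite \<L>" by (meson finite_imageI finite_subset)
  have "Y \<lhd> G\<lparr>carrier := K\<rparr>" if "Y \<in> \<L>" for Y
    using closed_normal_conj_preimage[OF K(1) Lcn] that by (auto simp: \<L>_def closed_normal_def)
  moreover have "finite Y" if Y: "Y \<in> \<L>" for Y
  proof -
    obtain g where g: "g \<in> carrier G" "Y = conj_preimage g L" using Y by (auto simp: \<L>_def)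
    have "Y \<subseteq> (\<lambda>z. inv g \<otimes> z \<otimes> g) ` L"
    proof
      fix y assume "y \<in> Y"
      then have y: "y \<in> carrier G" "g \<otimes> y \<otimes> inv g \<in> L" using g by (auto simp: conj_preimage_def)
      have "y = inv g \<otimes> (g \<otimes> y \<otimes> inv g) \<otimes> g" using y(1) g(1) by (simp add: m_assoc cancel_inv)
      then show "y \<in> (\<lambda>z. inv g \<otimes> z \<otimes> g) ` L" using y(2) by (rule image_eqI)
    qed
    then show ?thesis by (rule finite_surj[OF L(2)])
  qed
  ultimately have "\<exists>M. M \<lhd> G\<lparr>carrier := K\<rparr> \<and> finite M \<and> \<Union>\<L> \<subseteq> M"
    by (intro K.finite_normal_cover[OF fin])
  then obtain M where M: "M \<lhd> G\<lparr>carrier := K\<rparr>" "finite M" "\<Union>\<L> \<subseteq> M" by (elim exE conjE)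
  have "subgroup M G" using M(1) unfolding normal_in_subgroup_iff[OF Kn(2)] by blast
  then have "generate G (\<Union>\<L>) \<subseteq> M" using generate_subgroup_incl[OF M(3)] by blast
  then have "finite (generate G (\<Union>\<L>))" using M(2) finite_subset by blast
  moreover have "generate G (\<Union>\<L>) \<lhd> G"
  proof (rule normal_generateI)
    show "\<Union>\<L> \<subseteq> carrier G" by (auto simp: \<L>_def conj_preimage_def)
    fix h y assume "h \<in> \<Union>\<L>" and y: "y \<in> carrier G"
    then obtain g where g: "g \<in> carrier G" "h \<in> carrier G" "g \<otimes> h \<otimes> inv g \<in> L"
      by (auto simp: \<L>_def conj_preimage_def)
    have "(g \<otimes> inv y) \<otimes> (y \<otimes> h \<otimes> inv y) \<otimes> inv (g \<otimes> inv y) = g \<otimes> h \<otimes> inv g"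
      using g(1,2) y by (simp add: m_assoc inv_mult_group cancel_inv)
    then have "y \<otimes> h \<otimes> inv y \<in> conj_preimage (g \<otimes> inv y) L"
      using g y by (simp add: conj_preimage_def)
    then show "y \<otimes> h \<otimes> inv y \<in> \<Union>\<L>" using g y by (auto simp: \<L>_def)
  qed
  ultimately have "generate G (\<Union>\<L>) = {\<one>}" by (rule finite_normal_trivial[rotated])
  moreover have "conj_preimage \<one> L = L" using Lc by (auto simp: conj_preimage_def)
  then have "L \<in> \<L>" unfolding \<L>_def by force
  then have "L \<subseteq> generate G (\<Union>\<L>)" by (auto intro: generate.incl)
  ultimately have "L \<subseteq> {\<one>}" by simp
  then show False using L(3) subgroup.one_closed[OF Ln(1)] by blast
qed

text \<open>Generalized obliquity. Otherwise let \<open>K\<close> be minimal with infinitely many closed normal subgroups of \<open>G\<close> inside \<open>K\<close> and outside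
  \<open>H\<close>. Those other than \<open>K\<close> lie in maximal closed normal subgroups of \<open>K\<close>, of which there are
  finitely many because the normal Frattini subgroup of \<open>K\<close> is open, and hence in their cores in
  \<open>G\<close>. So one of these cores contradicts the minimality of \<open>K\<close>.\<close>
theorem obliquity:
  assumes H: "openin T H" "\<one> \<in> H"
  shows "finite {N. closed_normal G T N \<and> \<not> N \<subseteq> H}"
proof (rule ccontr)
  define \<N> where "\<N> = {N. closed_normal G T N \<and> \<not> N \<subseteq> H}"
  assume inf: "infinite {N. closed_normal G T N \<and> \<not> N \<subseteq> H}"
  define \<S> where "\<S> = {K. closed_normal G T K \<and> infinite {N \<in> \<N>. N \<subseteq> K}}"
  have "\<exists>K\<in>\<S>. \<forall>X\<in>\<S>. X \<subseteq> K \<longrightarrow> X = K"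
  proof (rule downward_Zorn)
    have "{N \<in> \<N>. N \<subseteq> carrier G} = \<N>" by (auto simp: \<N>_def dest: closed_normalD)
    then have "carrier G \<in> \<S>" using inf closed_normal_carrier by (simp add: \<S>_def \<N>_def)
    then show "\<S> \<noteq> {}" by blast
    fix C assume C: "C \<noteq> {}" "subset.chain \<S> C"
    have CS: "\<And>K. K \<in> C \<Longrightarrow> K \<in> \<S>" using C(2) by (auto simp: subset_chain_def)
    have Icn: "closed_normal G T (\<Inter>C)" using CS C(1) by (intro closed_normal_Inter) (auto simp: \<S>_def)
    \<comment> \<open>By compactness the intersection of the chain is not inside \<open>H\<close>. So it is non-trivial, only
      finitely many closed normal subgroups contain it, and the chain is finite.\<close>
    have "\<Inter>((\<lambda>K. K - H) ` C) \<noteq> {}"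
    proof (rule chain_Inter_nonempty, unfold subset_chain_def, intro conjI ballI subsetI)
      fix Y assume "Y \<in> (\<lambda>K. K - H) ` C"
      then obtain K where K: "K \<in> C" "Y = K - H" by blast
      then have Kcn: "closed_normal G T K" and "infinite {N \<in> \<N>. N \<subseteq> K}" using CS by (auto simp: \<S>_def)
      then obtain N where "N \<in> \<N>" "N \<subseteq> K" using not_finite_existsD by blast
      then have "Y \<noteq> {}" using K(2) by (auto simp: \<N>_def)
      then show "Y \<in> {C. closedin T C \<and> C \<noteq> {}}"
        using K(2) closed_normalD(3)[OF Kcn] H(1) by (simp add: closedin_diff)
    next
      fix Y Z assume "Y \<in> (\<lambda>K. K - H) ` C" "Z \<in> (\<lambda>K. K - H) ` C"
      then obtain K M where "K \<in> C" "Y = K - H" "M \<in> C" "Z = M - H" by blast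
      moreover have "K \<subseteq> M \<or> M \<subseteq> K" using C(2) calculation by (auto simp: subset_chain_def)
      ultimately show "Y \<subseteq> Z \<or> Z \<subseteq> Y" by blast
    qed
    then have "\<Inter>C \<noteq> {\<one>}" using H(2) C(1) by auto
    from finite_closed_normals_above[OF Icn this] have "finite C"
      by (rule rev_finite_subset) (use CS in \<open>auto simp: \<S>_def\<close>)
    then have "\<Inter>C \<in> C" using Inter_in_chain C by blast
    then show "\<Inter>C \<in> \<S>" using CS by blast
  qed
  then obtain K where K: "K \<in> \<S>" "\<And>X. X \<in> \<S> \<Longrightarrow> X \<subseteq> K \<Longrightarrow> X = K" by blast
  have Kcn: "closed_normal G T K" and Kinf: "infinite {N \<in> \<N>. N \<subseteq> K}"
    using K(1) by (auto simp: \<S>_def)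
  note Kn = closed_normalD[OF Kcn]
  interpret K: profinite_group "G\<lparr>carrier := K\<rparr>" "subtopology T K"
    using closed_subgroup_profinite Kn by blast
  note cn = closed_normal_in_subgroup_iff[OF Kn(2,3)]
  have "K \<noteq> {\<one>}"
  proof
    assume "K = {\<one>}"
    then have "{N \<in> \<N>. N \<subseteq> K} \<subseteq> Pow {\<one>}" by auto
    then show False using Kinf finite_subset by blast
  qed
  then have ne: "normal_Frattini_of G T K \<noteq> {\<one>}" using normal_Frattini_of_nontrivial Kcn by blast
  let ?max = "maximal_closed_normal (G\<lparr>carrier := K\<rparr>) (subtopology T K)"
  have "finite {U. ?max U}"
  proof -
    note Fcn = normal_Frattini_of_closed_normal(1)[OF Kcn]
    have "finite {U. subgroup U G \<and> normal_Frattini_of G T K \<subseteq> U}"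
      using open_normal_if_nontrivial[OF Fcn ne] closed_normalD[OF Fcn]
      by (intro finite_subgroups_above open_subgroup_finite_index) (auto simp: open_normal_def)
    then show ?thesis
      by (rule rev_finite_subset) (auto simp: maximal_closed_normal_def cn normal_Frattini_def)
  qed
  define core where "core U = \<Inter>((\<lambda>g. conj_preimage g U) ` carrier G)" for U
  have "finite {N \<in> \<N>. N \<subseteq> core U}" if U: "?max U" for U
  proof -
    have Ucn: "closed_normal (G\<lparr>carrier := K\<rparr>) (subtopology T K) U" "U \<noteq> K"
      using U by (auto simp: maximal_closed_normal_def)
    then have Un: "subgroup U G" "closedin T U" "U \<subseteq> K" by (auto simp: cn)
    have "conj_preimage \<one> U = U" using Un(3) Kn(4) by (auto simp: conj_preimage_def)
    then have coreU: "core U \<subseteq> U" unfolding core_def by (intro Inter_lower) force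
    have "closed_normal G T (core U)"
      unfolding closed_normal_def
    proof
      show "closedin T (core U)"
        unfolding core_def conj_preimage_def
        by (intro closedin_Inter) (auto intro!: closedin_preimage continuous_intros_group Un)
      show "core U \<lhd> G"
      proof (rule normal_invI)
        show "subgroup (core U) G"
          unfolding core_def by (intro subgroups_Inter) (auto intro: conj_preimage_subgroup Un)
        fix x h assume x: "x \<in> carrier G" and h: "h \<in> core U"
        have hc: "h \<in> carrier G" using h coreU Un(3) Kn(4) by blast
        have "g \<otimes> (x \<otimes> h \<otimes> inv x) \<otimes> inv g \<in> U" if g: "g \<in> carrier G" for g
        proof -
          have "h \<in> conj_preimage (g \<otimes> x) U" using h g x by (auto simp: core_def)
          then show ?thesis using g x hc by (simp add: conj_preimage_def m_assoc inv_mult_group)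
        qed
        then show "x \<otimes> h \<otimes> inv x \<in> core U" using x hc by (auto simp: core_def conj_preimage_def)
      qed
    qed
    moreover have "core U \<noteq> K" "core U \<subseteq> K" using coreU Un(3) Ucn(2) by auto
    ultimately show ?thesis using K(2)[of "core U"] by (auto simp: \<S>_def)
  qed
  then have "finite (insert K (\<Union>U\<in>{U. ?max U}. {N \<in> \<N>. N \<subseteq> core U}))"
    using \<open>finite {U. ?max U}\<close> by blast
  moreover have "{N \<in> \<N>. N \<subseteq> K} \<subseteq> insert K (\<Union>U\<in>{U. ?max U}. {N \<in> \<N>. N \<subseteq> core U})"
  proof
    fix N assume N: "N \<in> {N \<in> \<N>. N \<subseteq> K}"
    show "N \<in> insert K (\<Union>U\<in>{U. ?max U}. {N \<in> \<N>. N \<subseteq> core U})"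
    proof (cases "N = K")
      case False
      have "closed_normal G T N" using N by (auto simp: \<N>_def)
      note Nn = closed_normalD[OF this]
      have "closed_normal (G\<lparr>carrier := K\<rparr>) (subtopology T K) N"
        unfolding cn using Nn N Kn(4) normal.inv_op_closed2[OF Nn(1)] by auto
      then obtain U where U: "?max U" "N \<subseteq> U"
        using K.maximal_closed_normal_exists False by auto
      have "N \<subseteq> conj_preimage g U" if "g \<in> carrier G" for g
        using U(2) Nn(4) normal.inv_op_closed2[OF Nn(1) that] by (auto simp: conj_preimage_def)
      then have "N \<subseteq> core U" by (auto simp: core_def)
      then show ?thesis using N U by blast
    qed simp
  qed
  ultimately show False using Kinf finite_subset by blast
qed

end

section \<open>Automorphisms induced on a section\<close>

lemma nat_copy_of_finite_group:
  fixes Q :: "('c, 'd) monoid_scheme"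
  assumes "group Q" "finite (carrier Q)"
  obtains X :: "nat monoid" where "group X" "Q \<cong> X"
proof -
  interpret Q: group Q by fact
  obtain f :: "'c \<Rightarrow> nat" where f: "inj_on f (carrier Q)"
    using finite_imp_inj_to_nat_seg[OF assms(2)] by blast
  define h where "h = inv_into (carrier Q) f"
  define X where "X = \<lparr>carrier = f ` carrier Q, mult = (\<lambda>a b. f (h a \<otimes>\<^bsub>Q\<^esub> h b)), one = f \<one>\<^bsub>Q\<^esub>\<rparr>"
  have hom: "f \<in> hom Q X"
    by (rule homI) (use f in \<open>auto simp: X_def h_def\<close>)
  have "X\<lparr>carrier := f ` carrier Q, one := f \<one>\<^bsub>Q\<^esub>\<rparr> = X" by (simp add: X_def)
  then have "group X" using Q.hom_imp_img_group[OF hom] by simp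
  moreover have "f \<in> iso Q X"
    using hom f by (auto simp: iso_def bij_betw_def X_def)
  ultimately show thesis using that by (auto simp: is_iso_def)
qed

text \<open>An isomorphism from the quotient by \<open>H\<close>, seen as an epimorphism with kernel \<open>H\<close>.\<close>
lemma (in normal) epimorphism_of_quotient_iso:
  assumes X: "group X" and iso: "G Mod H \<cong> X"
  obtains p where "p \<in> hom G X" "p ` carrier G = carrier X" "kernel G X p = H"
proof -
  obtain f where f: "f \<in> iso (G Mod H) X" using iso by (auto simp: is_iso_def)
  interpret Q: group "G Mod H" by (rule factorgroup_is_group)
  interpret X: group X by fact
  have fh: "f \<in> hom (G Mod H) X" and fb: "bij_betw f (carrier (G Mod H)) (carrier X)"
    using f by (auto simp: iso_def)
  interpret f: group_hom "G Mod H" X f by unfold_locales (rule fh)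
  define p where "p x = f (H #> x)" for x
  have "p \<in> hom G X"
    using Group.hom_compose[OF r_coset_hom_Mod fh] by (simp add: p_def[abs_def] o_def)
  moreover have "p ` carrier G = carrier X"
    using bij_betw_imp_surj_on[OF fb] by (auto simp: p_def[abs_def] carrier_FactGroup image_image)
  moreover have "kernel G X p = H"
  proof -
    have "f (H #> x) = \<one>\<^bsub>X\<^esub> \<longleftrightarrow> x \<in> H" if x: "x \<in> carrier G" for x
    proof -
      have "H #> x \<in> carrier (G Mod H)" "H \<in> carrier (G Mod H)"
        using x Q.one_closed by (auto simp: carrier_FactGroup)
      moreover have "f H = \<one>\<^bsub>X\<^esub>" using f.hom_one by simp
      ultimately have "f (H #> x) = \<one>\<^bsub>X\<^esub> \<longleftrightarrow> H #> x = H"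
        using bij_betw_imp_inj_on[OF fb] by (metis inj_onD)
      also have "\<dots> \<longleftrightarrow> x \<in> H" using x coset_join1 coset_join2 subgroup_axioms subset by metis
      finally show ?thesis .
    qed
    then show ?thesis using subset by (auto simp: kernel_def p_def)
  qed
  ultimately show thesis using that by blast
qed

text \<open>The centralizer of the section \<open>M/N\<close>: the elements \<open>g\<close> with \<open>[g, M] \<subseteq> N\<close>.\<close>
definition (in group) section_centralizer :: "'a set \<Rightarrow> 'a set \<Rightarrow> 'a set" where
  "section_centralizer M N = {g \<in> carrier G. \<forall>m\<in>M. g \<otimes> m \<otimes> inv g \<otimes> inv m \<in> N}"

text \<open>A section \<open>M/N\<close> of \<open>G\<close> with \<open>M\<close> and \<open>N\<close> normal in \<open>G\<close>, presented by an epimorphism \<open>p\<close> from \<open>M\<close>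
  onto a group \<open>X\<close> with kernel \<open>N\<close>. Then \<open>G\<close> acts on \<open>X\<close> by conjugation, and \<open>M\<close> acts by all inner
  automorphisms.\<close>
locale group_section = group G for G :: "('a, 'b) monoid_scheme" (structure) +
  fixes M N :: "'a set" and X :: "('c, 'd) monoid_scheme" and p :: "'a \<Rightarrow> 'c"
  assumes M: "M \<lhd> G" and N: "N \<lhd> G" and NM: "N \<subseteq> M" and X: "group X"
    and p_hom: "p \<in> hom (G\<lparr>carrier := M\<rparr>) X" and p_surj: "p ` M = carrier X"
    and p_kernel: "kernel (G\<lparr>carrier := M\<rparr>) X p = N"
begin

sublocale X: group X by (rule X)

lemma Msub: "subgroup M G" using M by (rule normal_imp_subgroup)

sublocale p: group_hom "G\<lparr>carrier := M\<rparr>" X p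
  using subgroup_imp_group[OF Msub] X p_hom by (simp add: group_hom_def group_hom_axioms_def)

lemma Mc: "m \<in> M \<Longrightarrow> m \<in> carrier G" using subgroup.mem_carrier[OF Msub] .

lemma p_mult: "a \<in> M \<Longrightarrow> b \<in> M \<Longrightarrow> p (a \<otimes> b) = p a \<otimes>\<^bsub>X\<^esub> p b"
  using p.hom_mult by simp

lemma p_inv: "a \<in> M \<Longrightarrow> p (inv a) = inv\<^bsub>X\<^esub> p a"
  using p.hom_inv[of a] m_inv_consistent[OF Msub] by simp

lemma p_closed: "a \<in> M \<Longrightarrow> p a \<in> carrier X"
  using p_surj by blast

lemma p_one_iff: "a \<in> M \<Longrightarrow> p a = \<one>\<^bsub>X\<^esub> \<longleftrightarrow> a \<in> N"
  using p_kernel by (auto simp: kernel_def)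

lemma M_closed: "a \<in> M \<Longrightarrow> b \<in> M \<Longrightarrow> a \<otimes> b \<in> M" "a \<in> M \<Longrightarrow> inv a \<in> M"
  using Msub by (simp_all add: subgroup.m_closed subgroup.m_inv_closed)

lemma M_conj: "g \<in> carrier G \<Longrightarrow> m \<in> M \<Longrightarrow> g \<otimes> m \<otimes> inv g \<in> M"
  using normal.inv_op_closed2[OF M] .

lemma p_eq_iff: "a \<in> M \<Longrightarrow> b \<in> M \<Longrightarrow> p a = p b \<longleftrightarrow> a \<otimes> inv b \<in> N"
  using p_one_iff[of "a \<otimes> inv b"] X.inv_solve_right'[of "\<one>\<^bsub>X\<^esub>" "p a" "p b"]
  by (simp add: M_closed p_mult p_inv p_closed)

lemma p_conj_cong:
  assumes g: "g \<in> carrier G" and m: "m \<in> M" "m' \<in> M" "p m = p m'"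
  shows "p (g \<otimes> m \<otimes> inv g) = p (g \<otimes> m' \<otimes> inv g)"
proof -
  have "g \<otimes> (m \<otimes> inv m') \<otimes> inv g \<in> N"
    using m normal.inv_op_closed2[OF N g] by (simp add: p_eq_iff)
  moreover have "g \<otimes> (m \<otimes> inv m') \<otimes> inv g = (g \<otimes> m \<otimes> inv g) \<otimes> inv (g \<otimes> m' \<otimes> inv g)"
    using g m by (simp add: Mc m_assoc inv_mult_group cancel_inv)
  ultimately show ?thesis using p_eq_iff M_conj g m by simp
qed

text \<open>The automorphism of \<open>X\<close> induced by conjugation by \<open>g\<close>. It is made extensional, as the elements
  of \<open>AutoGroup X\<close> are; the choice of preimages under \<open>p\<close> does not matter.\<close>
definition action :: "'a \<Rightarrow> 'c \<Rightarrow> 'c" where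
  "action g = (\<lambda>x\<in>carrier X. p (g \<otimes> inv_into M p x \<otimes> inv g))"

lemma action_p:
  assumes "g \<in> carrier G" "m \<in> M"
  shows "action g (p m) = p (g \<otimes> m \<otimes> inv g)"
proof -
  have "p m \<in> p ` M" using assms by blast
  then have "inv_into M p (p m) \<in> M" "p (inv_into M p (p m)) = p m"
    by (simp_all only: inv_into_into f_inv_into_f)
  from p_conj_cong[OF assms(1) this(1) assms(2) this(2)] show ?thesis
    using assms by (simp add: action_def p_closed)
qed

lemma action_closed: "g \<in> carrier G \<Longrightarrow> x \<in> carrier X \<Longrightarrow> action g x \<in> carrier X"
  unfolding p_surj[symmetric] by (auto simp: action_p M_conj)

lemma action_mult:
  assumes "g \<in> carrier G" "h \<in> carrier G" "x \<in> carrier X"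
  shows "action (g \<otimes> h) x = action g (action h x)"
proof -
  obtain m where m: "m \<in> M" "x = p m" using assms(3) unfolding p_surj[symmetric] by blast
  have "g \<otimes> h \<otimes> m \<otimes> inv (g \<otimes> h) = g \<otimes> (h \<otimes> m \<otimes> inv h) \<otimes> inv g"
    using assms m by (simp add: Mc m_assoc inv_mult_group)
  then show ?thesis using assms m by (simp add: action_p M_conj)
qed

lemma action_one: "x \<in> carrier X \<Longrightarrow> action \<one> x = x"
  unfolding p_surj[symmetric] by (auto simp: action_p Mc)

lemma action_auto: "g \<in> carrier G \<Longrightarrow> action g \<in> carrier (AutoGroup X)"
proof -
  assume g: "g \<in> carrier G"
  have "action g \<in> hom X X"
  proof (rule homI)
    fix x y assume "x \<in> carrier X" "y \<in> carrier X"
    then obtain m k where m: "m \<in> M" "x = p m" "k \<in> M" "y = p k" using p_surj by blast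
    have "g \<otimes> (m \<otimes> k) \<otimes> inv g = (g \<otimes> m \<otimes> inv g) \<otimes> (g \<otimes> k \<otimes> inv g)"
      using g m by (simp add: Mc m_assoc cancel_inv)
    then show "action g (x \<otimes>\<^bsub>X\<^esub> y) = action g x \<otimes>\<^bsub>X\<^esub> action g y"
      using g m by (simp add: action_p p_mult[symmetric] M_closed M_conj)
  qed (rule action_closed[OF g])
  moreover have "bij_betw (action g) (carrier X) (carrier X)"
  proof (rule bij_betw_byWitness[where f' = "action (inv g)"])
    show "\<forall>x\<in>carrier X. action (inv g) (action g x) = x"
      using g by (simp add: action_mult[symmetric] action_one)
    show "\<forall>x\<in>carrier X. action g (action (inv g) x) = x"
      using g by (simp add: action_mult[symmetric] action_one)
  qed (use g action_closed in auto)
  ultimately show ?thesis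
    by (simp add: AutoGroup_def auto_def Bij_def action_def)
qed

lemma mult_AutoGroup:
  assumes "f \<in> carrier (AutoGroup X)" "h \<in> carrier (AutoGroup X)"
  shows "f \<otimes>\<^bsub>AutoGroup X\<^esub> h = compose (carrier X) f h"
  using assms by (simp add: AutoGroup_def BijGroup_def auto_def)

lemma action_hom: "action \<in> hom G (AutoGroup X)"
proof (rule homI)
  fix g h assume gh: "g \<in> carrier G" "h \<in> carrier G"
  have "action (g \<otimes> h) = compose (carrier X) (action g) (action h)"
  proof
    fix x show "action (g \<otimes> h) x = compose (carrier X) (action g) (action h) x"
      using action_mult[OF gh] by (cases "x \<in> carrier X") (auto simp: compose_def action_def)
  qed
  then show "action (g \<otimes> h) = action g \<otimes>\<^bsub>AutoGroup X\<^esub> action h"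
    using gh by (simp add: mult_AutoGroup action_auto)
qed (rule action_auto)

lemma kernel_action: "kernel G (AutoGroup X) action = section_centralizer M N"
proof -
  have one: "\<one>\<^bsub>AutoGroup X\<^esub> = (\<lambda>x\<in>carrier X. x)" by (simp add: AutoGroup_def BijGroup_def)
  have "action g = \<one>\<^bsub>AutoGroup X\<^esub> \<longleftrightarrow> (\<forall>m\<in>M. g \<otimes> m \<otimes> inv g \<otimes> inv m \<in> N)" if g: "g \<in> carrier G" for g
  proof -
    have "action g = \<one>\<^bsub>AutoGroup X\<^esub> \<longleftrightarrow> (\<forall>x\<in>carrier X. action g x = x)"
      unfolding one by (auto simp: action_def fun_eq_iff)
    also have "\<dots> \<longleftrightarrow> (\<forall>m\<in>M. p (g \<otimes> m \<otimes> inv g) = p m)"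
      using g by (simp add: p_surj[symmetric] action_p)
    finally show ?thesis using g by (simp add: p_eq_iff M_conj)
  qed
  then show ?thesis by (auto simp: kernel_def section_centralizer_def)
qed

lemma Inn_subset_action: "Inn X \<subseteq> action ` carrier G"
proof
  fix f assume "f \<in> Inn X"
  then obtain m where m: "m \<in> M" and f: "f = (\<lambda>x\<in>carrier X. p m \<otimes>\<^bsub>X\<^esub> x \<otimes>\<^bsub>X\<^esub> inv\<^bsub>X\<^esub> p m)"
    unfolding Inn_def p_surj[symmetric] by blast
  have "f x = action m x" for x
  proof (cases "x \<in> carrier X")
    case True
    then obtain k where "k \<in> M" "x = p k" using p_surj by blast
    then show ?thesis using m True by (simp add: f action_p Mc p_mult p_inv M_closed)
  qed (simp add: f action_def)
  then show "f \<in> action ` carrier G" using m Mc by blast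
qed

lemma section_centralizer_normal: "section_centralizer M N \<lhd> G"
proof -
  interpret a: group_hom G "AutoGroup X" action
    using X.AutoGroup action_hom by (simp add: group_hom_def group_hom_axioms_def)
  show ?thesis using a.normal_kernel kernel_action by simp
qed

lemma quotient_between_Inn_Aut:
  obtains B where "subgroup B (AutoGroup X)" "Inn X \<subseteq> B"
    "G Mod section_centralizer M N \<cong> (AutoGroup X)\<lparr>carrier := B\<rparr>"
proof -
  interpret Aut: group "AutoGroup X" by (rule X.AutoGroup)
  interpret a: group_hom G "AutoGroup X" action by unfold_locales (rule action_hom)
  let ?B = "action ` carrier G"
  have B: "subgroup ?B (AutoGroup X)" using a.img_is_subgroup .
  interpret B: group "(AutoGroup X)\<lparr>carrier := ?B\<rparr>" using Aut.subgroup_imp_group[OF B] .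
  interpret b: group_hom G "(AutoGroup X)\<lparr>carrier := ?B\<rparr>" action
    by unfold_locales (use action_hom in \<open>auto simp: hom_def\<close>)
  have "G Mod kernel G ((AutoGroup X)\<lparr>carrier := ?B\<rparr>) action \<cong> (AutoGroup X)\<lparr>carrier := ?B\<rparr>"
    by (rule b.FactGroup_iso) simp
  moreover have "kernel G ((AutoGroup X)\<lparr>carrier := ?B\<rparr>) action = section_centralizer M N"
    using kernel_action by (simp add: kernel_def)
  ultimately show thesis using that[OF B Inn_subset_action] by simp
qed

lemma subset_section_centralizer: "N \<subseteq> section_centralizer M N"
proof
  fix n assume n: "n \<in> N"
  then have nc: "n \<in> carrier G" using NM Mc by blast
  have "n \<otimes> m \<otimes> inv n \<otimes> inv m \<in> N" if m: "m \<in> M" for m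
  proof -
    have "n \<otimes> (m \<otimes> inv n \<otimes> inv m) \<in> N"
      using n normal.inv_op_closed2[OF N Mc[OF m]] normal_imp_subgroup[OF N]
      by (simp add: subgroup.m_closed subgroup.m_inv_closed)
    then show ?thesis using nc Mc[OF m] by (simp add: m_assoc)
  qed
  then show "n \<in> section_centralizer M N" using nc by (simp add: section_centralizer_def)
qed

lemma not_subset_section_centralizer:
  assumes "\<not> comm_group X"
  shows "\<not> M \<subseteq> section_centralizer M N"
proof
  assume sub: "M \<subseteq> section_centralizer M N"
  have "x \<otimes>\<^bsub>X\<^esub> y = y \<otimes>\<^bsub>X\<^esub> x" if xy: "x \<in> carrier X" "y \<in> carrier X" for x y
  proof -
    obtain m k where m: "m \<in> M" "x = p m" "k \<in> M" "y = p k" using xy p_surj by blast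
    have "(m \<otimes> k) \<otimes> inv (k \<otimes> m) = m \<otimes> k \<otimes> inv m \<otimes> inv k"
      using m by (simp add: Mc m_assoc inv_mult_group)
    then have "(m \<otimes> k) \<otimes> inv (k \<otimes> m) \<in> N" using sub m by (auto simp: section_centralizer_def)
    then show ?thesis using m p_eq_iff by (simp add: p_mult[symmetric] M_closed)
  qed
  then show False using assms X.group_comm_groupI by blast
qed

end

section \<open>The dichotomy\<close>

text \<open>The pairs of closed normal subgroups whose quotient belongs to the class.\<close>
definition class_sections ::
  "nat monoid set \<Rightarrow> ('a, 'b) monoid_scheme \<Rightarrow> 'a topology \<Rightarrow> ('a set \<times> 'a set) set" where
  "class_sections \<F> G T = {(M, N). closed_normal G T M \<and> closed_normal G T N \<and> N \<subseteq> M \<and>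
     in_class (G\<lparr>carrier := M\<rparr> Mod N) \<F>}"

lemma (in topological_group) epimorphism_of_class_section:
  assumes "closed_normal G T M" "N \<lhd> G\<lparr>carrier := M\<rparr>"
    and "in_class (G\<lparr>carrier := M\<rparr> Mod N) \<F>" "\<And>X. X \<in> \<F> \<Longrightarrow> group X"
  obtains X p where "X \<in> \<F>" "p \<in> hom (G\<lparr>carrier := M\<rparr>) X" "p ` M = carrier X"
    "kernel (G\<lparr>carrier := M\<rparr>) X p = N"
proof -
  obtain X where X: "X \<in> \<F>" "G\<lparr>carrier := M\<rparr> Mod N \<cong> X" using assms(3) by (auto simp: in_class_def)
  interpret N: normal N "G\<lparr>carrier := M\<rparr>" by (rule assms(2))
  show thesis
    using N.epimorphism_of_quotient_iso[OF assms(4)[OF X(1)] X(2)] that X(1) by auto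
qed

lemma (in topological_group) closed_normal_in_closed_normal:
  assumes "closed_normal G T M" "closed_normal G T N" "N \<subseteq> M"
  shows "N \<lhd> G\<lparr>carrier := M\<rparr>"
  using closed_normalD[OF assms(1)] closed_normalD[OF assms(2)] assms(3)
  by (simp add: normal_in_subgroup_iff normal.inv_op_closed2 subset_iff)

context just_infinite_profinite_group
begin

lemma class_section_properties:
  assumes F: "finite_group_class \<F>" "\<forall>X\<in>\<F>. \<not> comm_group X"
    and MN: "(M, N) \<in> class_sections \<F> G T"
  defines "C \<equiv> section_centralizer M N"
  shows "open_normal G T C" "\<not> M \<subseteq> C" "in_class (G Mod C) (between_Inn_Aut \<F>)"
    "open_normal G T N" "open_normal G T M"
proof -
  have M: "closed_normal G T M" and N: "closed_normal G T N" and NM: "N \<subseteq> M"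
    and cl: "in_class (G\<lparr>carrier := M\<rparr> Mod N) \<F>"
    using MN by (auto simp: class_sections_def)
  note Mn = closed_normalD[OF M] and Nn = closed_normalD[OF N]
  have Fgrp: "group X" "finite (carrier X)" if "X \<in> \<F>" for X
    using F(1) that unfolding finite_group_class_def by blast+
  obtain X p where X: "X \<in> \<F>" and p: "p \<in> hom (G\<lparr>carrier := M\<rparr>) X" "p ` M = carrier X"
    "kernel (G\<lparr>carrier := M\<rparr>) X p = N"
    using epimorphism_of_class_section[OF M closed_normal_in_closed_normal[OF M N NM] cl Fgrp(1)] .
  interpret s: group_section G M N X p
    using Mn(1) Nn(1) NM Fgrp(1)[OF X] p
    by (simp add: group_section_def group_section_axioms_def)
  show MC: "\<not> M \<subseteq> C" using s.not_subset_section_centralizer F(2) X by (simp add: C_def)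
  have Cn: "C \<lhd> G" using s.section_centralizer_normal by (simp add: C_def)
  \<comment> \<open>If \<open>N\<close> were trivial, \<open>M\<close> would be a finite normal subgroup, hence trivial.\<close>
  have "N \<noteq> {\<one>}"
  proof
    assume "N = {\<one>}"
    then have "inj_on p M"
      using s.p_eq_iff s.Mc by (intro inj_onI) (metis inv_closed inv_equality inv_inv singletonD)
    then have "finite M" using p(2) Fgrp(2)[OF X] finite_imageD by metis
    then have "M = {\<one>}" using finite_normal_trivial Mn(1) by blast
    then show False using MC subgroup.one_closed[OF normal_imp_subgroup[OF Cn]] by blast
  qed
  then show No: "open_normal G T N" using open_normal_if_nontrivial N by blast
  have "M \<noteq> {\<one>}" using MC subgroup.one_closed[OF normal_imp_subgroup[OF Cn]] by blast
  then show "open_normal G T M" using open_normal_if_nontrivial M by blast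
  have "openin T C"
    using open_subgroup_superset[OF normal_imp_subgroup[OF Cn], of N] No
      s.subset_section_centralizer subgroup.one_closed[OF Nn(2)]
    by (simp add: open_normal_def C_def)
  then show Co: "open_normal G T C" using Cn by (simp add: open_normal_def)
  have fin: "finite (carrier (G Mod C))"
    using open_subgroup_finite_index[OF normal_imp_subgroup[OF Cn] \<open>openin T C\<close>]
    by (simp add: FactGroup_def)
  have grp: "group (G Mod C)" using normal.factorgroup_is_group[OF Cn] .
  obtain A :: "nat monoid" where A: "group A" "G Mod C \<cong> A"
    using nat_copy_of_finite_group[OF grp fin] .
  obtain B where B: "subgroup B (AutoGroup X)" "Inn X \<subseteq> B" "G Mod C \<cong> (AutoGroup X)\<lparr>carrier := B\<rparr>"
    using s.quotient_between_Inn_Aut unfolding C_def by blast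
  have "A \<cong> (AutoGroup X)\<lparr>carrier := B\<rparr>"
    using iso_trans[OF group.iso_sym[OF grp A(2)] B(3)] .
  then have "A \<in> between_Inn_Aut \<F>" using A(1) B X by (auto simp: between_Inn_Aut_def)
  then show "in_class (G Mod C) (between_Inn_Aut \<F>)" using A(2) by (auto simp: in_class_def)
qed

text \<open>If the sections have infinitely many centralizers \<open>C\<close>, these intersect trivially. Otherwise each
  \<open>C\<close> belongs to finitely many \<open>M\<close>, because \<open>M\<close> is not inside \<open>C\<close>; so some \<open>M\<close> occurs with
  infinitely many \<open>N\<close>, and these intersect trivially.\<close>
theorem residually_dichotomy:
  assumes F: "finite_group_class \<F>" "\<forall>X\<in>\<F>. \<not> comm_group X"
    and inf: "infinite (class_sections \<F> G T)"
  shows "residually (between_Inn_Aut \<F>) G T \<or>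
    (\<exists>H. open_normal G T H \<and> residually \<F> (G\<lparr>carrier := H\<rparr>) (subtopology T H))"
proof -
  define c where "c = (\<lambda>(M, N). section_centralizer M N)"
  let ?P = "class_sections \<F> G T"
  note props = class_section_properties[OF F]
  show ?thesis
  proof (cases "finite (c ` ?P)")
    case False
    have c: "open_normal G T C" "in_class (G Mod C) (between_Inn_Aut \<F>)" if "C \<in> c ` ?P" for C
      using that props by (auto simp: c_def)
    have "\<Inter>(c ` ?P) = {\<one>}"
      using infinite_closed_normals_Inter[OF False] c open_normal_imp_closed_normal by blast
    then have "residual (between_Inn_Aut \<F>) G T \<subseteq> {\<one>}"
      using c unfolding residual_def by blast
    moreover have "\<one> \<in> residual (between_Inn_Aut \<F>) G T"
      by (auto simp: residual_def open_normal_def intro: subgroup.one_closed normal_imp_subgroup)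
    ultimately show ?thesis unfolding residually_def by blast
  next
    case True
    have fst_sub: "fst ` ?P \<subseteq> (\<Union>C\<in>c ` ?P. {M. closed_normal G T M \<and> \<not> M \<subseteq> C})"
    proof
      fix M assume "M \<in> fst ` ?P"
      then obtain N where N: "(M, N) \<in> ?P" by auto
      then have "closed_normal G T M" by (simp add: class_sections_def)
      moreover have "section_centralizer M N \<in> c ` ?P" using N by (force simp: c_def)
      ultimately show "M \<in> (\<Union>C\<in>c ` ?P. {M. closed_normal G T M \<and> \<not> M \<subseteq> C})"
        using props(2)[OF N] by blast
    qed
    have "finite {M. closed_normal G T M \<and> \<not> M \<subseteq> C}" if C: "C \<in> c ` ?P" for C
    proof -
      have "open_normal G T C" using C props by (auto simp: c_def)
      then show ?thesis
        by (intro obliquity) (auto simp: open_normal_def intro: subgroup.one_closed normal_imp_subgroup)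
    qed
    then have "finite (fst ` ?P)" by (intro finite_subset[OF fst_sub] finite_UN_I True)
    from inf_img_fin_dom'[OF this inf]
    obtain M where M: "M \<in> fst ` ?P" "infinite (fst -` {M} \<inter> ?P)" by blast
    define \<N> where "\<N> = {N. (M, N) \<in> ?P}"
    have "fst -` {M} \<inter> ?P \<subseteq> Pair M ` \<N>" by (auto simp: \<N>_def)
    then have "infinite \<N>" using M(2) finite_subset by blast
    then have I: "\<Inter>\<N> = {\<one>}"
      by (rule infinite_closed_normals_Inter) (simp add: \<N>_def class_sections_def)
    have Mo: "open_normal G T M" using M(1) props(5) by auto
    note Mn = closed_normalD[OF open_normal_imp_closed_normal[OF Mo]]
    have "open_normal (G\<lparr>carrier := M\<rparr>) (subtopology T M) N \<and> in_class (G\<lparr>carrier := M\<rparr> Mod N) \<F>"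
      if N: "N \<in> \<N>" for N
    proof -
      have MN: "(M, N) \<in> ?P" using N by (simp add: \<N>_def)
      then have "closed_normal G T M" "closed_normal G T N" "N \<subseteq> M" "in_class (G\<lparr>carrier := M\<rparr> Mod N) \<F>"
        by (auto simp: class_sections_def)
      moreover have "openin (subtopology T M) N"
        using props(4)[OF MN] \<open>N \<subseteq> M\<close> by (auto simp: openin_subtopology open_normal_def)
      ultimately show ?thesis using closed_normal_in_closed_normal by (simp add: open_normal_def)
    qed
    then have "residual \<F> (G\<lparr>carrier := M\<rparr>) (subtopology T M) \<subseteq> \<Inter>\<N>"
      unfolding residual_def by blast
    moreover have "\<one> \<in> residual \<F> (G\<lparr>carrier := M\<rparr>) (subtopology T M)"
      using subgroup.one_closed[OF Mn(2)] subgroup.one_closed[OF normal_imp_subgroup]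
      by (fastforce simp: residual_def open_normal_def)
    ultimately have "residually \<F> (G\<lparr>carrier := M\<rparr>) (subtopology T M)"
      unfolding residually_def using I by auto
    then show ?thesis using Mo by blast
  qed
qed

end

section \<open>The normal Frattini height\<close>

lemma (in group) finite_discrete_profinite:
  assumes "finite (carrier G)"
  shows "profinite_group G (discrete_topology (carrier G))"
proof unfold_locales
  have "prod_topology (discrete_topology (carrier G)) (discrete_topology (carrier G)) =
      discrete_topology (carrier G \<times> carrier G)"
    by (simp add: prod_topology_discrete_topology)
  then show "continuous_map (prod_topology (discrete_topology (carrier G)) (discrete_topology (carrier G)))
      (discrete_topology (carrier G)) (\<lambda>(x, y). x \<otimes> y)"
    by auto
  show "\<exists>x. S \<subseteq> {x}" if "connectedin (discrete_topology (carrier G)) S" for S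
    using that by (metis connectedin_discrete_topology)
qed (use assms in \<open>auto simp: compact_space_discrete_topology\<close>)

lemma (in topological_group) normal_Frattini_iter_Suc:
  "normal_Frattini_iter G T (Suc n) = normal_Frattini_of G T (normal_Frattini_iter G T n)"
  by (simp add: normal_Frattini_iter_def)

lemma (in profinite_group) funpow_normal_Frattini_closed_normal:
  assumes "closed_normal G T H"
  shows "closed_normal G T ((normal_Frattini_of G T ^^ n) H) \<and> (normal_Frattini_of G T ^^ n) H \<subseteq> H"
proof (induction n)
  case (Suc n)
  then show ?case using normal_Frattini_of_closed_normal by fastforce
qed (use assms in simp)

lemma (in profinite_group) normal_Frattini_of_psubset:
  assumes K: "closed_normal G T K" "K \<noteq> {\<one>}"
  shows "normal_Frattini_of G T K \<subset> K"
proof -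
  interpret K: profinite_group "G\<lparr>carrier := K\<rparr>" "subtopology T K"
    using closed_subgroup_profinite closed_normalD[OF K(1)] by blast
  show ?thesis
    using normal_Frattini_of_closed_normal(2)[OF K(1)] K.normal_Frattini_proper K(2) by auto
qed

lemma (in profinite_group) normal_Frattini_of_one: "normal_Frattini_of G T {\<one>} = {\<one>}"
  using normal_Frattini_of_closed_normal[OF closed_normal_one]
    subgroup.one_closed[OF closed_normalD(2)] by blast

context group
begin

text \<open>The iterates shrink strictly until they are trivial, so in particular the minimum that defines
  the height of a finite group is attained.\<close>
lemma normal_Frattini_iter_finite:
  assumes fin: "finite (carrier G)"
  defines "D \<equiv> discrete_topology (carrier G)"
  shows "\<exists>n\<le>card (carrier G). normal_Frattini_iter G D n = {\<one>}"
proof (rule ccontr)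
  assume "\<not> ?thesis"
  then have ne: "normal_Frattini_iter G D n \<noteq> {\<one>}" if "n \<le> card (carrier G)" for n
    using that by blast
  interpret profinite_group G D unfolding D_def by (rule finite_discrete_profinite[OF fin])
  have cn: "closed_normal G D (normal_Frattini_iter G D n)" for n
    using funpow_normal_Frattini_closed_normal[OF closed_normal_carrier]
    by (simp add: normal_Frattini_iter_def)
  have "n \<le> Suc (card (carrier G)) \<Longrightarrow> card (normal_Frattini_iter G D n) + n \<le> card (carrier G)" for n
  proof (induction n)
    case (Suc n)
    have "normal_Frattini_iter G D (Suc n) \<subset> normal_Frattini_iter G D n"
      using normal_Frattini_of_psubset[OF cn] ne Suc.prems by (simp add: normal_Frattini_iter_Suc)
    moreover have "finite (normal_Frattini_iter G D n)"
      using closed_normalD(4)[OF cn] fin finite_subset by blast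
    ultimately have "card (normal_Frattini_iter G D (Suc n)) < card (normal_Frattini_iter G D n)"
      by (rule psubset_card_mono[rotated])
    then show ?case using Suc by simp
  qed (simp add: normal_Frattini_iter_def)
  from this[of "Suc (card (carrier G))"] show False by simp
qed

lemma Frattini_height_le_card:
  assumes "finite (carrier G)"
  shows "Frattini_height G \<le> card (carrier G)"
  using normal_Frattini_iter_finite[OF assms] unfolding Frattini_height_def
  by (meson Least_le le_trans)

lemma normal_Frattini_iter_above_height:
  assumes fin: "finite (carrier G)" and n: "Frattini_height G \<le> n"
  shows "normal_Frattini_iter G (discrete_topology (carrier G)) n = {\<one>}"
proof -
  let ?D = "discrete_topology (carrier G)"
  interpret profinite_group G ?D by (rule finite_discrete_profinite[OF fin])
  have "\<exists>n. normal_Frattini_iter G ?D n = {\<one>}" using normal_Frattini_iter_finite[OF fin] by blast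
  then have *: "normal_Frattini_iter G ?D (Frattini_height G) = {\<one>}"
    unfolding Frattini_height_def by (rule LeastI_ex)
  show ?thesis using n
    by (induction n rule: dec_induct) (simp_all only: * normal_Frattini_iter_Suc normal_Frattini_of_one)
qed

end

text \<open>An epimorphism \<open>p\<close> from \<open>H\<close> onto a finite group is compatible with normal Frattini subgroups:
  let \<open>V\<close> be the preimage in \<open>A\<close> of a maximal normal subgroup \<open>M\<close> of \<open>B\<close>. The image of \<open>A\<close> in the
  simple group \<open>B/M\<close> is normal, so \<open>V = A\<close> or \<open>A/V \<cong> B/M\<close>; in the second case \<open>V\<close> is maximal.\<close>
lemma (in profinite_group) normal_Frattini_of_image_subset:
  fixes X :: "('c, 'd) monoid_scheme" and p :: "'a \<Rightarrow> 'c"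
  assumes H: "closed_normal G T H"
    and X: "group X" "finite (carrier X)"
    and p: "p \<in> hom (G\<lparr>carrier := H\<rparr>) X" "p ` H = carrier X"
    and ker: "openin T (kernel (G\<lparr>carrier := H\<rparr>) X p)"
    and A: "closed_normal G T A" "A \<subseteq> H"
    and B: "closed_normal X (discrete_topology (carrier X)) B" "p ` A \<subseteq> B"
  shows "p ` normal_Frattini_of G T A \<subseteq> normal_Frattini_of X (discrete_topology (carrier X)) B"
proof -
  let ?D = "discrete_topology (carrier X)"
  interpret X: profinite_group X ?D using group.finite_discrete_profinite[OF X] .
  note Hn = closed_normalD[OF H] and An = closed_normalD[OF A(1)] and Bn = X.closed_normalD[OF B(1)]
  have pm: "p (a \<otimes> b) = p a \<otimes>\<^bsub>X\<^esub> p b" if "a \<in> H" "b \<in> H" for a b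
    using hom_mult[OF p(1)] that by simp
  interpret p: group_hom "G\<lparr>carrier := H\<rparr>" X p
    using subgroup_imp_group[OF Hn(2)] X(1) p(1) by (simp add: group_hom_def group_hom_axioms_def)
  have pinv: "p (inv a) = inv\<^bsub>X\<^esub> p a" if "a \<in> H" for a
    using p.hom_inv[of a] that m_inv_consistent[OF Hn(2)] by simp
  have pone: "p \<one> = \<one>\<^bsub>X\<^esub>" using p.hom_one by simp
  have pc: "p a \<in> carrier X" if "a \<in> H" for a using p(2) that by blast
  have Hc: "a \<in> carrier G" if "a \<in> H" for a using that Hn(4) by blast
  have Hcl: "\<And>a b. a \<in> H \<Longrightarrow> b \<in> H \<Longrightarrow> a \<otimes> b \<in> H" "\<And>a. a \<in> H \<Longrightarrow> inv a \<in> H"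
    using Hn(2) by (simp_all add: subgroup.m_closed subgroup.m_inv_closed)
  have pconj: "p (a \<otimes> b \<otimes> inv a) = p a \<otimes>\<^bsub>X\<^esub> p b \<otimes>\<^bsub>X\<^esub> inv\<^bsub>X\<^esub> p a" if "a \<in> H" "b \<in> H" for a b
    using that by (simp add: pm pinv Hcl)
  note cnA = closed_normal_in_subgroup_iff[OF An(2,3)]
  note cnB = X.closed_normal_in_subgroup_iff[OF Bn(2,3)]
  let ?cnA = "closed_normal (G\<lparr>carrier := A\<rparr>) (subtopology T A)"
  let ?cnB = "closed_normal (X\<lparr>carrier := B\<rparr>) (subtopology ?D B)"
  interpret A: profinite_group "G\<lparr>carrier := A\<rparr>" "subtopology T A"
    using closed_subgroup_profinite An by blast
  interpret B: profinite_group "X\<lparr>carrier := B\<rparr>" "subtopology ?D B"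
    using X.closed_subgroup_profinite Bn by blast
  have img_sub: "subgroup (p ` W) X" if "subgroup W G" "W \<subseteq> H" for W
    using p.subgroup_img_is_subgroup[of W] subgroup_incl[OF that(1) Hn(2) that(2)] by simp
  have "p a \<in> M" if a: "a \<in> normal_Frattini_of G T A"
    and M: "maximal_closed_normal (X\<lparr>carrier := B\<rparr>) (subtopology ?D B) M" for a M
  proof (cases "p ` A \<subseteq> M")
    case True
    then show ?thesis using a by (auto simp: normal_Frattini_def)
  next
    case False
    have Mcn: "?cnB M" and MB: "M \<noteq> B" and Mmax: "\<And>J. ?cnB J \<Longrightarrow> M \<subseteq> J \<Longrightarrow> J = M \<or> J = B"
      using M by (auto simp: maximal_closed_normal_def)
    have Ms: "subgroup M X" "M \<subseteq> B" and Mk: "\<And>k n. k \<in> B \<Longrightarrow> n \<in> M \<Longrightarrow> k \<otimes>\<^bsub>X\<^esub> n \<otimes>\<^bsub>X\<^esub> inv\<^bsub>X\<^esub> k \<in> M"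
      using Mcn unfolding cnB by auto
    have Mn: "M \<lhd> X\<lparr>carrier := B\<rparr>" using Mcn by (simp add: closed_normal_def)
    have cnB_iff: "?cnB J \<longleftrightarrow> subgroup J X \<and> J \<subseteq> B \<and> (\<forall>k\<in>B. \<forall>n\<in>J. k \<otimes>\<^bsub>X\<^esub> n \<otimes>\<^bsub>X\<^esub> inv\<^bsub>X\<^esub> k \<in> J)" for J
      unfolding cnB using Bn(4) by auto
    have prod_sub: "subgroup (M <#>\<^bsub>X\<^esub> p ` W) X" "M <#>\<^bsub>X\<^esub> p ` W \<subseteq> B"
      "M \<subseteq> M <#>\<^bsub>X\<^esub> p ` W" "p ` W \<subseteq> M <#>\<^bsub>X\<^esub> p ` W"
      if W: "subgroup W G" "W \<subseteq> A" for W
    proof -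
      have pW: "subgroup (p ` W) X" "p ` W \<subseteq> B"
        using img_sub[OF W(1) subset_trans[OF W(2) A(2)]] subset_trans[OF image_mono[OF W(2)] B(2)] .
      then have pWB: "subgroup (p ` W) (X\<lparr>carrier := B\<rparr>)" using X.subgroup_incl Bn(2) by blast
      interpret S: second_isomorphism_grp M "X\<lparr>carrier := B\<rparr>" "p ` W"
        using Mn pWB by (simp add: second_isomorphism_grp_def second_isomorphism_grp_axioms_def)
      have "subgroup (M <#>\<^bsub>X\<^esub> p ` W) (X\<lparr>carrier := B\<rparr>)"
        using S.normal_set_mult_subgroup by (simp add: set_mult_def)
      then show "subgroup (M <#>\<^bsub>X\<^esub> p ` W) X" "M <#>\<^bsub>X\<^esub> p ` W \<subseteq> B"
        using X.incl_subgroup[OF Bn(2)] subgroup.subset by fastforce+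
      show "M \<subseteq> M <#>\<^bsub>X\<^esub> p ` W" "p ` W \<subseteq> M <#>\<^bsub>X\<^esub> p ` W"
        using X.set_mult_supersets[OF Ms(1) pW(1)] .
    qed
    have MA: "M <#>\<^bsub>X\<^esub> p ` A = B"
    proof -
      note ps = prod_sub[OF An(2) subset_refl]
      have "k \<otimes>\<^bsub>X\<^esub> n \<otimes>\<^bsub>X\<^esub> inv\<^bsub>X\<^esub> k \<in> M <#>\<^bsub>X\<^esub> p ` A"
        if k: "k \<in> B" and n: "n \<in> M <#>\<^bsub>X\<^esub> p ` A" for k n
      proof -
        obtain m a where ma: "m \<in> M" "a \<in> A" "n = m \<otimes>\<^bsub>X\<^esub> p a" using n by (auto simp: set_mult_def)
        obtain h where h: "h \<in> H" "k = p h" using k Bn(4) unfolding p(2)[symmetric] by blast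
        have aH: "a \<in> H" using ma A(2) by blast
        have mc: "m \<in> carrier X" using ma Ms Bn(4) by blast
        have "k \<otimes>\<^bsub>X\<^esub> n \<otimes>\<^bsub>X\<^esub> inv\<^bsub>X\<^esub> k = (k \<otimes>\<^bsub>X\<^esub> m \<otimes>\<^bsub>X\<^esub> inv\<^bsub>X\<^esub> k) \<otimes>\<^bsub>X\<^esub> p (h \<otimes> a \<otimes> inv h)"
          using h aH mc by (simp add: pconj ma(3) pc X.m_assoc X.cancel_inv)
        moreover have "h \<otimes> a \<otimes> inv h \<in> A" using normal.inv_op_closed2[OF An(1) Hc] h ma by blast
        ultimately show ?thesis using Mk[OF k ma(1)] by (auto simp: set_mult_def)
      qed
      then have "?cnB (M <#>\<^bsub>X\<^esub> p ` A)" unfolding cnB_iff using ps by blast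
      then show ?thesis using Mmax ps False by blast
    qed
    define V where "V = {v \<in> A. p v \<in> M}"
    have AH: "v \<in> H" if "v \<in> A" for v using that A(2) by blast
    have Vs: "subgroup V G"
    proof (rule subgroupI)
      show "V \<subseteq> carrier G" using An(4) by (auto simp: V_def)
      have "\<one> \<in> V" using pone subgroup.one_closed[OF An(2)] subgroup.one_closed[OF Ms(1)] by (simp add: V_def)
      then show "V \<noteq> {}" by blast
      show "inv a \<in> V" if "a \<in> V" for a
        using that An(2) Ms(1) AH by (simp add: V_def pinv subgroup.m_inv_closed)
      show "a \<otimes> b \<in> V" if "a \<in> V" "b \<in> V" for a b
        using that An(2) Ms(1) AH by (simp add: V_def pm subgroup.m_closed)
    qed
    have Vclosed: "closedin T V"
    proof -
      let ?L = "{v \<in> H. p v \<in> M}"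
      have "subgroup ?L G"
      proof (rule subgroupI)
        show "?L \<subseteq> carrier G" using Hc by auto
        have "\<one> \<in> ?L" using pone subgroup.one_closed[OF Hn(2)] subgroup.one_closed[OF Ms(1)] by simp
        then show "?L \<noteq> {}" by blast
        show "inv a \<in> ?L" if "a \<in> ?L" for a
          using that Hcl Ms(1) by (simp add: pinv subgroup.m_inv_closed)
        show "a \<otimes> b \<in> ?L" if "a \<in> ?L" "b \<in> ?L" for a b
          using that Hcl Ms(1) by (simp add: pm subgroup.m_closed)
      qed
      moreover have "kernel (G\<lparr>carrier := H\<rparr>) X p \<subseteq> ?L"
        using subgroup.one_closed[OF Ms(1)] by (auto simp: kernel_def)
      moreover have "\<one> \<in> kernel (G\<lparr>carrier := H\<rparr>) X p"
        using pone subgroup.one_closed[OF Hn(2)] by (simp add: kernel_def)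
      ultimately have "closedin T ?L" using open_subgroup_superset ker open_subgroup_closed by blast
      moreover have "V = A \<inter> ?L" using A(2) by (auto simp: V_def)
      ultimately show ?thesis using An(3) by (simp add: closedin_Int)
    qed
    have Vcn: "?cnA V"
      unfolding cnA using Vs Vclosed Mk B(2) AH An(2)
      by (auto simp: V_def pconj subgroup.m_closed subgroup.m_inv_closed)
    have "maximal_closed_normal (G\<lparr>carrier := A\<rparr>) (subtopology T A) V"
      unfolding maximal_closed_normal_def
    proof (intro conjI allI impI)
      show "?cnA V" by (rule Vcn)
      show "V \<noteq> carrier (G\<lparr>carrier := A\<rparr>)" using False by (auto simp: V_def)
      fix W assume "?cnA W \<and> V \<subseteq> W"
      then have W: "subgroup W G" "W \<subseteq> A" "V \<subseteq> W" and Wk: "\<And>k n. k \<in> A \<Longrightarrow> n \<in> W \<Longrightarrow> k \<otimes> n \<otimes> inv k \<in> W"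
        unfolding cnA by auto
      note ps = prod_sub[OF W(1,2)]
      let ?J = "M <#>\<^bsub>X\<^esub> p ` W"
      have "k \<otimes>\<^bsub>X\<^esub> n \<otimes>\<^bsub>X\<^esub> inv\<^bsub>X\<^esub> k \<in> ?J" if k: "k \<in> B" and n: "n \<in> ?J" for k n
      proof -
        obtain m w where mw: "m \<in> M" "w \<in> W" "n = m \<otimes>\<^bsub>X\<^esub> p w" using n by (auto simp: set_mult_def)
        obtain l a where la: "l \<in> M" "a \<in> A" "k = l \<otimes>\<^bsub>X\<^esub> p a"
          using k unfolding MA[symmetric] by (auto simp: set_mult_def)
        have wH: "w \<in> H" "a \<in> H" using mw la W(2) A(2) by auto
        have mc: "m \<in> carrier X" "l \<in> carrier X" using mw la Ms Bn(4) by auto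
        have pa: "p a \<in> B" using la B(2) by blast
        define n' where "n' = (p a \<otimes>\<^bsub>X\<^esub> m \<otimes>\<^bsub>X\<^esub> inv\<^bsub>X\<^esub> p a) \<otimes>\<^bsub>X\<^esub> p (a \<otimes> w \<otimes> inv a)"
        have "n' \<in> ?J" using Mk[OF pa mw(1)] Wk[OF la(2) mw(2)] by (auto simp: n'_def set_mult_def)
        moreover have "l \<in> ?J" using la ps by blast
        ultimately have "l \<otimes>\<^bsub>X\<^esub> n' \<otimes>\<^bsub>X\<^esub> inv\<^bsub>X\<^esub> l \<in> ?J"
          using ps(1) by (simp add: subgroup.m_closed subgroup.m_inv_closed)
        moreover have "l \<otimes>\<^bsub>X\<^esub> n' \<otimes>\<^bsub>X\<^esub> inv\<^bsub>X\<^esub> l = k \<otimes>\<^bsub>X\<^esub> n \<otimes>\<^bsub>X\<^esub> inv\<^bsub>X\<^esub> k"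
          using wH mc
          by (simp add: n'_def mw(3) la(3) pconj pc X.m_assoc X.cancel_inv X.inv_mult_group)
        ultimately show ?thesis by simp
      qed
      then have "?cnB ?J" unfolding cnB_iff using ps by blast
      then consider "?J = M" | "?J = B" using Mmax ps(3) by blast
      then show "W = V \<or> W = carrier (G\<lparr>carrier := A\<rparr>)"
      proof cases
        case 1
        then have "W \<subseteq> V" using ps(4) W(2) by (auto simp: V_def)
        then show ?thesis using W(3) by blast
      next
        case 2
        have "A \<subseteq> W"
        proof
          fix a assume a: "a \<in> A"
          then have "p a \<in> ?J" using 2 B(2) by blast
          then obtain m w where mw: "m \<in> M" "w \<in> W" "p a = m \<otimes>\<^bsub>X\<^esub> p w" by (auto simp: set_mult_def)
          have c: "m \<in> carrier X" "w \<in> H" "a \<in> H" "w \<in> A" using mw Ms Bn(4) W(2) A(2) a by auto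
          have "p (a \<otimes> inv w) = m" using c mw(3) by (simp add: pm pinv Hcl pc X.m_assoc)
          moreover have "a \<otimes> inv w \<in> A" using a c An(2) by (simp add: subgroup.m_closed subgroup.m_inv_closed)
          ultimately have "a \<otimes> inv w \<in> W" using mw(1) W(3) by (auto simp: V_def)
          then have "a \<otimes> inv w \<otimes> w \<in> W" using mw(2) W(1) by (simp add: subgroup.m_closed)
          then show "a \<in> W" using c Hc by (simp add: m_assoc)
        qed
        then show ?thesis using W(2) by auto
      qed
    qed
    then have "a \<in> V" using a by (simp add: normal_Frattini_def)
    then show ?thesis by (simp add: V_def)
  qed
  moreover have "p a \<in> B" if "a \<in> normal_Frattini_of G T A" for a
    using that B(2) by (auto simp: normal_Frattini_def)
  ultimately show ?thesis by (auto simp: normal_Frattini_def[of "X\<lparr>carrier := B\<rparr>"])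
qed

context just_infinite_profinite_group
begin

lemma funpow_normal_Frattini_nontrivial:
  assumes "closed_normal G T H" "H \<noteq> {\<one>}"
  shows "(normal_Frattini_of G T ^^ n) H \<noteq> {\<one>}"
proof (induction n)
  case (Suc n)
  then show ?case
    using normal_Frattini_of_nontrivial funpow_normal_Frattini_closed_normal[OF assms(1)] by simp
qed (use assms in simp)

text \<open>An epimorphism from \<open>H\<close> to a group \<open>X\<close> in the class maps the iterated normal Frattini subgroups
  of \<open>H\<close> into those of \<open>X\<close>. If all heights were at most \<open>n\<close>, the \<open>n\<close>-th iterate for \<open>H\<close> would lie in
  the residual and be trivial, but none of the iterates for \<open>H\<close> is trivial.\<close>
theorem residually_imp_unbounded_height:
  assumes H: "open_normal G T H"
    and C: "\<And>X. X \<in> \<C> \<Longrightarrow> group X" "\<And>X. X \<in> \<C> \<Longrightarrow> finite (carrier X)"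
    and res: "residually \<C> (G\<lparr>carrier := H\<rparr>) (subtopology T H)"
  shows "unbounded_height \<C>"
  unfolding unbounded_height_def
proof (rule ccontr)
  assume "\<not> (\<forall>n. \<exists>X\<in>\<C>. n \<le> Frattini_height X)"
  then obtain n where n: "\<And>X. X \<in> \<C> \<Longrightarrow> Frattini_height X \<le> n" by (metis nle_le)
  have Hcn: "closed_normal G T H" using open_normal_imp_closed_normal[OF H] .
  note Hn = closed_normalD[OF Hcn]
  define A where "A i = (normal_Frattini_of G T ^^ i) H" for i
  have A: "closed_normal G T (A i)" "A i \<subseteq> H" for i
    using funpow_normal_Frattini_closed_normal[OF Hcn] by (auto simp: A_def)
  have "A n \<subseteq> N" if N: "open_normal (G\<lparr>carrier := H\<rparr>) (subtopology T H) N"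
    and cl: "in_class (G\<lparr>carrier := H\<rparr> Mod N) \<C>" for N
  proof -
    have Nn: "N \<lhd> G\<lparr>carrier := H\<rparr>" and "openin (subtopology T H) N" using N by (auto simp: open_normal_def)
    then have No: "openin T N"
      using H openin_open_subtopology by (auto simp: open_normal_def)
    obtain X p where X: "X \<in> \<C>" and p: "p \<in> hom (G\<lparr>carrier := H\<rparr>) X" "p ` H = carrier X"
      "kernel (G\<lparr>carrier := H\<rparr>) X p = N"
      using epimorphism_of_class_section[OF Hcn Nn cl C(1)] .
    let ?D = "discrete_topology (carrier X)"
    interpret X: profinite_group X ?D using group.finite_discrete_profinite C X by blast
    have "p ` A i \<subseteq> normal_Frattini_iter X ?D i" for i
    proof (induction i)
      case 0
      then show ?case using p(2) by (simp add: A_def normal_Frattini_iter_def)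
    next
      case (Suc i)
      have "closed_normal X ?D (normal_Frattini_iter X ?D i)"
        using X.funpow_normal_Frattini_closed_normal[OF X.closed_normal_carrier]
        by (simp add: normal_Frattini_iter_def)
      from normal_Frattini_of_image_subset[OF Hcn C(1)[OF X] C(2)[OF X] p(1,2) _ A this Suc] p(3) No
      show ?case by (simp add: A_def X.normal_Frattini_iter_Suc)
    qed
    moreover have "normal_Frattini_iter X ?D n = {\<one>\<^bsub>X\<^esub>}"
      using X.normal_Frattini_iter_above_height C(2)[OF X] n[OF X] by blast
    ultimately have "p ` A n \<subseteq> {\<one>\<^bsub>X\<^esub>}" by metis
    then have "A n \<subseteq> kernel (G\<lparr>carrier := H\<rparr>) X p" using A(2)[of n] by (auto simp: kernel_def)
    then show ?thesis using p(3) by simp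
  qed
  then have "A n \<subseteq> residual \<C> (G\<lparr>carrier := H\<rparr>) (subtopology T H)"
    using A(2) by (auto simp: residual_def)
  then have "A n \<subseteq> {\<one>}" using res by (simp add: residually_def)
  then have "A n = {\<one>}" using subgroup.one_closed[OF closed_normalD(2)[OF A(1)]] by blast
  moreover have "H \<noteq> {\<one>}"
  proof
    assume "H = {\<one>}"
    then have "finite (rcosets {\<one>})"
      using open_subgroup_finite_index[OF Hn(2)] H by (simp add: open_normal_def)
    moreover have "finite C" if "C \<in> rcosets {\<one>}" for C using rcosets_finite[OF that] by simp
    ultimately have "finite (\<Union>(rcosets {\<one>}))" by blast
    then show False using infinite_carrier rcosets_part_G[OF triv_subgroup] by simp
  qed
  ultimately show False using funpow_normal_Frattini_nontrivial[OF Hcn] by (simp add: A_def)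
qed

end

section \<open>Finitely many isomorphism classes\<close>

lemma finite_group_classD:
  assumes "finite_group_class \<F>" "X \<in> \<F>"
  shows "group X" "finite (carrier X)"
  using assms unfolding finite_group_class_def by blast+

lemma finite_iso_classes_bounded_card:
  assumes F: "finite_group_class \<F>" and fin: "finite (iso_classes \<F>)"
  obtains n where "\<And>X. X \<in> \<F> \<Longrightarrow> card (carrier X) \<le> n"
proof -
  let ?R = "{(X, Y) \<in> \<F> \<times> \<F>. X \<cong> Y}"
  have "(\<lambda>X. card (carrier X)) ` \<F> \<subseteq> (\<lambda>c. card (carrier (SOME Y. Y \<in> c))) ` iso_classes \<F>"
  proof safe
    fix X assume X: "X \<in> \<F>"
    let ?c = "?R `` {X}"
    have "X \<in> ?c" using X by simp
    then have "(SOME Y. Y \<in> ?c) \<in> ?c" by (rule someI)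
    then have "card (carrier X) = card (carrier (SOME Y. Y \<in> ?c))" by (intro iso_same_card) blast
    moreover have "?c \<in> iso_classes \<F>" using X unfolding iso_classes_def by (rule quotientI)
    ultimately show "card (carrier X) \<in> (\<lambda>c. card (carrier (SOME Y. Y \<in> c))) ` iso_classes \<F>"
      by blast
  qed
  then have "finite ((\<lambda>X. card (carrier X)) ` \<F>)" using fin finite_surj by blast
  then obtain n where "\<forall>k\<in>(\<lambda>X. card (carrier X)) ` \<F>. k \<le> n"
    using finite_nat_set_iff_bounded_le by blast
  then show thesis using that by blast
qed

lemma carrier_AutoGroup_subset: "carrier (AutoGroup F) \<subseteq> carrier F \<rightarrow>\<^sub>E carrier F"
proof
  fix f assume "f \<in> carrier (AutoGroup F)"
  then have "f \<in> Bij (carrier F)" by (simp add: AutoGroup_def auto_def)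
  then show "f \<in> carrier F \<rightarrow>\<^sub>E carrier F"
    using Bij_imp_extensional[of f] Bij_imp_funcset[of f] by (simp add: PiE_def)
qed

lemma between_Inn_Aut_finite:
  assumes F: "finite_group_class \<F>" and A: "A \<in> between_Inn_Aut \<F>"
  shows "group A" and "finite (carrier A)"
    and "\<exists>X\<in>\<F>. card (carrier A) \<le> card (carrier X) ^ card (carrier X)"
proof -
  show "group A" using A by (simp add: between_Inn_Aut_def)
  obtain X B where X: "X \<in> \<F>" and B: "subgroup B (AutoGroup X)" "A \<cong> (AutoGroup X)\<lparr>carrier := B\<rparr>"
    using A by (auto simp: between_Inn_Aut_def)
  have fX: "finite (carrier X)" using finite_group_classD[OF F X] by blast
  let ?E = "carrier X \<rightarrow>\<^sub>E carrier X"
  have E: "finite ?E" "card ?E = card (carrier X) ^ card (carrier X)"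
    using fX by (simp_all add: finite_PiE card_PiE)
  have "B \<subseteq> ?E" using subgroup.subset[OF B(1)] carrier_AutoGroup_subset by blast
  then have "finite B" "card B \<le> card ?E" using E(1) finite_subset card_mono by blast+
  then show "finite (carrier A)" "\<exists>X\<in>\<F>. card (carrier A) \<le> card (carrier X) ^ card (carrier X)"
    using iso_finite[OF B(2)] iso_same_card[OF B(2)] E(2) X by auto
qed

lemma bounded_card_not_unbounded_height:
  assumes "\<And>X. X \<in> \<C> \<Longrightarrow> group X \<and> finite (carrier X) \<and> card (carrier X) \<le> n"
  shows "\<not> unbounded_height \<C>"
proof
  assume "unbounded_height \<C>"
  then obtain X where X: "X \<in> \<C>" "Suc n \<le> Frattini_height X" by (auto simp: unbounded_height_def)
  then show False using group.Frattini_height_le_card[of X] assms[OF X(1)] by simp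
qed

text \<open>Heights are bounded by orders, and a group of automorphisms of a group of order \<open>k\<close> has order
  at most \<open>k ^ k\<close>.\<close>
lemma infinite_iso_classes_if_unbounded_height:
  assumes F: "finite_group_class \<F>"
    and unb: "unbounded_height (between_Inn_Aut \<F>) \<or> unbounded_height \<F>"
  shows "infinite (iso_classes \<F>)"
proof
  assume "finite (iso_classes \<F>)"
  then obtain n where n: "\<And>X. X \<in> \<F> \<Longrightarrow> card (carrier X) \<le> n"
    using finite_iso_classes_bounded_card[OF F] by blast
  have "\<not> unbounded_height \<F>"
    by (rule bounded_card_not_unbounded_height[where n = n])
      (simp add: n finite_group_classD[OF F])
  moreover have "\<not> unbounded_height (between_Inn_Aut \<F>)"
  proof (rule bounded_card_not_unbounded_height)
    fix A assume A: "A \<in> between_Inn_Aut \<F>"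
    obtain X where X: "X \<in> \<F>" "card (carrier A) \<le> card (carrier X) ^ card (carrier X)"
      using between_Inn_Aut_finite(3)[OF F A] by blast
    have "group X" "finite (carrier X)" using finite_group_classD[OF F X(1)] .
    then have "carrier X \<noteq> {}" using monoid.carrier_not_empty[OF group.is_monoid] by blast
    then have "1 \<le> card (carrier X)" using \<open>finite (carrier X)\<close> by (simp add: Suc_leI card_gt_0_iff)
    then have "card (carrier X) ^ card (carrier X) \<le> card (carrier X) ^ n"
      using n[OF X(1)] by (rule power_increasing[rotated])
    also have "\<dots> \<le> n ^ n" using n[OF X(1)] by (rule power_mono) simp
    finally show "group A \<and> finite (carrier A) \<and> card (carrier A) \<le> n ^ n"
      using X(2) between_Inn_Aut_finite(1,2)[OF F A] by simp
  qed
  ultimately show False using unb by blast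
qed

theorem (in just_infinite_profinite_group) class_sections_imp:
  assumes F: "finite_group_class \<F>" "\<forall>X\<in>\<F>. \<not> comm_group X"
    and inf: "infinite (class_sections \<F> G T)"
  shows "unbounded_height (between_Inn_Aut \<F>) \<or> unbounded_height \<F>"
    and "infinite (iso_classes \<F>)"
proof -
  have "open_normal G T (carrier G)"
    using normal_self openin_topspace[of T] by (simp add: open_normal_def topspace_eq)
  moreover have "subtopology T (carrier G) = T" by (metis subtopology_topspace topspace_eq)
  ultimately have "unbounded_height (between_Inn_Aut \<F>)" if "residually (between_Inn_Aut \<F>) G T"
    using residually_imp_unbounded_height[of "carrier G" "between_Inn_Aut \<F>"] that
      between_Inn_Aut_finite[OF F(1)] by simp
  moreover have "unbounded_height \<F>"
    if "open_normal G T H" "residually \<F> (G\<lparr>carrier := H\<rparr>) (subtopology T H)" for H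
    using residually_imp_unbounded_height[OF that(1) _ _ that(2)] finite_group_classD[OF F(1)]
    by blast
  ultimately show unb: "unbounded_height (between_Inn_Aut \<F>) \<or> unbounded_height \<F>"
    using residually_dichotomy[OF F inf] by blast
  show "infinite (iso_classes \<F>)" by (rule infinite_iso_classes_if_unbounded_height[OF F(1) unb])
qed

section \<open>Isomorphisms of topological groups\<close>

text \<open>An isomorphism of topological groups: an isomorphism that is also a homeomorphism.\<close>
locale topological_group_iso = P: topological_group P S + Q: topological_group Q R
  for P :: "('a, 'b) monoid_scheme" and S :: "'a topology"
    and Q :: "('c, 'd) monoid_scheme" and R :: "'c topology" +
  fixes f :: "'a \<Rightarrow> 'c"
  assumes f_iso: "f \<in> iso P Q" and f_homeo: "homeomorphic_map S R f"
begin

sublocale f: group_hom P Q f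
  using f_iso by unfold_locales (simp add: iso_def)

lemma f_bij: "bij_betw f (carrier P) (carrier Q)"
  using f_iso by (simp add: iso_def)

lemma f_image: "f ` carrier P = carrier Q"
  using f_bij by (simp add: bij_betw_def)

lemma f_inj: "inj_on f (carrier P)"
  using f_bij by (simp add: bij_betw_def)

lemma closed_normal_image:
  assumes "closed_normal P S N"
  shows "closed_normal Q R (f ` N)"
proof -
  note Nn = P.closed_normalD[OF assms]
  have "f ` N \<lhd> Q"
  proof (rule Q.normal_invI)
    show "subgroup (f ` N) Q" using f.subgroup_img_is_subgroup Nn(2) .
    fix y h assume "y \<in> carrier Q" "h \<in> f ` N"
    then obtain x n where x: "x \<in> carrier P" "y = f x" "n \<in> N" "h = f n" unfolding f_image[symmetric] by blast
    have "n \<in> carrier P" using x Nn(4) by blast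
    then have "y \<otimes>\<^bsub>Q\<^esub> h \<otimes>\<^bsub>Q\<^esub> inv\<^bsub>Q\<^esub> y = f (x \<otimes>\<^bsub>P\<^esub> n \<otimes>\<^bsub>P\<^esub> inv\<^bsub>P\<^esub> x)" using x by simp
    then show "y \<otimes>\<^bsub>Q\<^esub> h \<otimes>\<^bsub>Q\<^esub> inv\<^bsub>Q\<^esub> y \<in> f ` N" using normal.inv_op_closed2[OF Nn(1)] x by simp
  qed
  moreover have "closedin R (f ` N)"
    using homeomorphic_map_closedness_eq[OF f_homeo] Nn(3) by blast
  ultimately show ?thesis by (simp add: closed_normal_def)
qed

end

lemma topological_group_iso_inverse:
  assumes "topological_group_iso P S Q R f"
  shows "topological_group_iso Q R P S (inv_into (carrier P) f)"
proof -
  interpret topological_group_iso P S Q R f by fact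
  have "inv_into (carrier P) f \<in> iso Q P" using P.iso_set_sym[OF f_iso] .
  moreover have "homeomorphic_map R S (inv_into (carrier P) f)"
  proof -
    obtain g where g: "homeomorphic_maps S R f g" using f_homeo homeomorphic_map_maps by blast
    have "homeomorphic_map R S g" using g homeomorphic_maps_sym homeomorphic_map_maps by blast
    moreover have "g y = inv_into (carrier P) f y" if y: "y \<in> topspace R" for y
    proof -
      obtain x where x: "x \<in> carrier P" "y = f x"
        using y f_image Q.topspace_eq by auto
      have "g (f x) = x" using g x(1) P.topspace_eq by (simp add: homeomorphic_maps_def)
      then show ?thesis using x f_inj by simp
    qed
    ultimately show ?thesis by (metis homeomorphic_map_eq)
  qed
  ultimately show ?thesis by unfold_locales
qed

context topological_group_iso
begin

lemma normal_Frattini_subset_image: "normal_Frattini Q R \<subseteq> f ` normal_Frattini P S"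
proof
  fix y assume y: "y \<in> normal_Frattini Q R"
  then have "y \<in> carrier Q" by (simp add: normal_Frattini_def)
  then obtain x where x: "x \<in> carrier P" "y = f x" unfolding f_image[symmetric] by blast
  interpret g: topological_group_iso Q R P S "inv_into (carrier P) f"
    using topological_group_iso_inverse topological_group_iso_axioms by blast
  have "x \<in> N" if N: "maximal_closed_normal P S N" for N
  proof -
    have Ncn: "closed_normal P S N" "N \<noteq> carrier P"
      and Nmax: "\<And>M. closed_normal P S M \<Longrightarrow> N \<subseteq> M \<Longrightarrow> M = N \<or> M = carrier P"
      using N by (auto simp: maximal_closed_normal_def)
    have Nc: "N \<subseteq> carrier P" using P.closed_normalD(4)[OF Ncn(1)] .
    have "maximal_closed_normal Q R (f ` N)"
      unfolding maximal_closed_normal_def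
    proof (intro conjI allI impI)
      show "closed_normal Q R (f ` N)" using closed_normal_image Ncn(1) .
      show "f ` N \<noteq> carrier Q"
        using Ncn(2) Nc f_inj unfolding f_image[symmetric] by (simp add: inj_on_image_eq_iff)
      fix M assume M: "closed_normal Q R M \<and> f ` N \<subseteq> M"
      have Mc: "M \<subseteq> f ` carrier P" using Q.closed_normalD(4) M f_image by blast
      let ?M = "inv_into (carrier P) f ` M"
      have "closed_normal P S ?M" using g.closed_normal_image M by blast
      moreover have "N \<subseteq> ?M"
      proof
        fix n assume n: "n \<in> N"
        then have "inv_into (carrier P) f (f n) = n" using Nc f_inj by (auto intro: inv_into_f_f)
        then show "n \<in> ?M" using M n by force
      qed
      ultimately have "?M = N \<or> ?M = carrier P" using Nmax by blast
      moreover have "f ` ?M = M" using image_inv_into_cancel[OF refl Mc] .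
      ultimately show "M = f ` N \<or> M = carrier Q" using f_image by auto
    qed
    then have "f x \<in> f ` N" using y x by (simp add: normal_Frattini_def)
    then show ?thesis using inj_on_image_mem_iff[OF f_inj x(1) Nc] by simp
  qed
  then show "y \<in> f ` normal_Frattini P S" using x by (auto simp: normal_Frattini_def)
qed

end

lemma (in topological_group_iso) image_normal_Frattini:
  "f ` normal_Frattini P S = normal_Frattini Q R"
proof
  interpret g: topological_group_iso Q R P S "inv_into (carrier P) f"
    using topological_group_iso_inverse topological_group_iso_axioms by blast
  show "f ` normal_Frattini P S \<subseteq> normal_Frattini Q R"
  proof
    fix y assume "y \<in> f ` normal_Frattini P S"
    then obtain x where "x \<in> normal_Frattini P S" "y = f x" by blast
    then obtain z where z: "z \<in> normal_Frattini Q R" "y = f (inv_into (carrier P) f z)"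
      using g.normal_Frattini_subset_image by blast
    moreover have "z \<in> f ` carrier P" using z(1) f_image by (simp add: normal_Frattini_def)
    ultimately show "y \<in> normal_Frattini Q R" by (simp add: f_inv_into_f)
  qed
qed (rule normal_Frattini_subset_image)

lemma (in topological_group_iso) restrict:
  assumes D: "subgroup D P" "topological_group (P\<lparr>carrier := D\<rparr>) (subtopology S D)"
    and E: "topological_group (Q\<lparr>carrier := f ` D\<rparr>) (subtopology R (f ` D))"
  shows "topological_group_iso (P\<lparr>carrier := D\<rparr>) (subtopology S D)
    (Q\<lparr>carrier := f ` D\<rparr>) (subtopology R (f ` D)) f"
proof -
  have Dc: "D \<subseteq> carrier P" using subgroup.subset[OF D(1)] .
  have "f \<in> iso (P\<lparr>carrier := D\<rparr>) (Q\<lparr>carrier := f ` D\<rparr>)"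
    using Dc inj_on_subset[OF f_inj Dc] by (auto simp: iso_def hom_def bij_betw_def subset_iff)
  moreover have "homeomorphic_map (subtopology S D) (subtopology R (f ` D)) f"
  proof (rule homeomorphic_map_subtopologies[OF f_homeo])
    have "f ` D \<subseteq> carrier Q" using Dc f_image by blast
    then show "f ` (topspace S \<inter> D) = topspace R \<inter> f ` D"
      using Dc P.topspace_eq Q.topspace_eq by (simp add: Int_absorb1)
  qed
  ultimately show ?thesis
    using D(2) E by (simp add: topological_group_iso_def topological_group_iso_axioms_def)
qed

lemma (in topological_group_iso) quotient_iso:
  assumes N: "N \<lhd> P" "f ` N \<lhd> Q"
  shows "P Mod N \<cong> Q Mod (f ` N)"
proof -
  interpret N: normal "f ` N" Q by fact
  interpret M: group "Q Mod (f ` N)" by (rule N.factorgroup_is_group)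
  have Nc: "N \<subseteq> carrier P" using normal_imp_subgroup[OF N(1)] subgroup.subset by blast
  let ?h = "\<lambda>x. f ` N #>\<^bsub>Q\<^esub> f x"
  have "?h \<in> hom P (Q Mod (f ` N))"
    using Group.hom_compose[OF f.homh N.r_coset_hom_Mod] by (simp add: o_def)
  then interpret h: group_hom P "Q Mod (f ` N)" ?h by unfold_locales
  have "?h ` carrier P = carrier (Q Mod (f ` N))"
    by (simp add: carrier_FactGroup f_image[symmetric] image_image)
  then have "P Mod kernel P (Q Mod (f ` N)) ?h \<cong> Q Mod (f ` N)" by (rule h.FactGroup_iso)
  moreover have "kernel P (Q Mod (f ` N)) ?h = N"
  proof -
    have "f ` N #>\<^bsub>Q\<^esub> f x = f ` N \<longleftrightarrow> x \<in> N" if x: "x \<in> carrier P" for x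
    proof -
      have "f ` N #>\<^bsub>Q\<^esub> f x = f ` N \<longleftrightarrow> f x \<in> f ` N"
        using x f.hom_closed Q.coset_join1[OF _ _ N.subgroup_axioms]
          Q.coset_join2[OF _ N.subgroup_axioms] by metis
      then show ?thesis using inj_on_image_mem_iff[OF f_inj x Nc] by simp
    qed
    then show ?thesis using Nc by (auto simp: kernel_def)
  qed
  ultimately show ?thesis by simp
qed

section \<open>The quotient by the normal Frattini subgroup of the derived subgroup\<close>

context profinite_group
begin

lemma closed_normal_closure_of:
  assumes "N \<lhd> G"
  shows "closed_normal G T (T closure_of N)"
proof -
  have Ns: "subgroup N G" using normal_imp_subgroup[OF assms] .
  have Nc: "N \<subseteq> carrier G" using subgroup.subset[OF Ns] .
  have cl: "T closure_of N \<subseteq> carrier G" using closure_of_subset_topspace topspace_eq by metis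
  have sub: "N \<subseteq> T closure_of N" using closure_of_subset Nc topspace_eq by metis
  have img: "f x \<in> T closure_of N" if f: "continuous_map T T f" "f ` N \<subseteq> N" "x \<in> T closure_of N" for f x
  proof -
    have "f ` (T closure_of N) \<subseteq> T closure_of (f ` N)"
      using continuous_map_image_closure_subset[OF f(1)] .
    also have "\<dots> \<subseteq> T closure_of N" using closure_of_mono[OF f(2)] .
    finally show ?thesis using f(3) by blast
  qed
  have "subgroup (T closure_of N) G"
  proof (rule subgroupI[OF cl])
    show "T closure_of N \<noteq> {}" using sub subgroup.one_closed[OF Ns] by blast
    show "inv a \<in> T closure_of N" if "a \<in> T closure_of N" for a
      using that by (rule img[rotated 2])
        (use Ns in \<open>auto intro!: continuous_intros_group simp: subgroup.m_inv_closed\<close>)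
    fix a b assume a: "a \<in> T closure_of N" and b: "b \<in> T closure_of N"
    have ac: "a \<in> carrier G" using a cl by blast
    have "n \<otimes> b \<in> T closure_of N" if n: "n \<in> N" for n
      using b by (rule img[rotated 2])
        (use Ns n Nc in \<open>auto intro!: continuous_intros_group simp: subgroup.m_closed\<close>)
    then have "(\<lambda>x. x \<otimes> b) ` N \<subseteq> T closure_of N" by blast
    then have "T closure_of ((\<lambda>x. x \<otimes> b) ` N) \<subseteq> T closure_of N"
      using closure_of_minimal closedin_closure_of by metis
    moreover have "continuous_map T T (\<lambda>x. x \<otimes> b)"
      by (intro continuous_intros_group) (use b cl in blast)
    then have "(\<lambda>x. x \<otimes> b) ` (T closure_of N) \<subseteq> T closure_of ((\<lambda>x. x \<otimes> b) ` N)"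
      by (rule continuous_map_image_closure_subset)
    ultimately show "a \<otimes> b \<in> T closure_of N" using a by blast
  qed
  moreover have "x \<otimes> h \<otimes> inv x \<in> T closure_of N" if x: "x \<in> carrier G" and h: "h \<in> T closure_of N" for x h
  proof (rule img[of "\<lambda>h. x \<otimes> h \<otimes> inv x", OF _ _ h])
    show "continuous_map T T (\<lambda>h. x \<otimes> h \<otimes> inv x)"
      by (intro continuous_intros_group x inv_closed)
    show "(\<lambda>h. x \<otimes> h \<otimes> inv x) ` N \<subseteq> N" using normal.inv_op_closed2[OF assms x] by blast
  qed
  ultimately show ?thesis by (simp add: closed_normal_def normal_invI)
qed

lemma closed_derived_closed_normal:
  assumes "closed_normal G T K"
  shows "closed_normal G T (closed_derived G T K)" "closed_derived G T K \<subseteq> K"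
proof -
  note Kn = closed_normalD[OF assms]
  show "closed_normal G T (closed_derived G T K)"
    unfolding closed_derived_def by (intro closed_normal_closure_of derived_is_normal Kn)
  show "closed_derived G T K \<subseteq> K"
    unfolding closed_derived_def by (intro closure_of_minimal derived_incl Kn subset_refl)
qed

lemma derived_Frattini_closed_normal:
  assumes "closed_normal G T K"
  shows "closed_normal G T (normal_Frattini_of G T (closed_derived G T K))"
    "normal_Frattini_of G T (closed_derived G T K) \<subseteq> K"
  using closed_derived_closed_normal[OF assms] normal_Frattini_of_closed_normal by blast+

lemma derived_subset_closed_derived:
  "K \<subseteq> carrier G \<Longrightarrow> derived G K \<subseteq> closed_derived G T K"
  unfolding closed_derived_def
  by (intro closure_of_subset) (simp add: topspace_eq derived_in_carrier)

lemma derived_Frattini_quotient_iso: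
  assumes K: "closed_normal G T K" and H: "closed_normal G T H"
    and iso: "topgroup_iso (G\<lparr>carrier := K\<rparr>) (subtopology T K) (G\<lparr>carrier := H\<rparr>) (subtopology T H)"
  shows "derived_Frattini_quotient G T K \<cong> derived_Frattini_quotient G T H"
proof -
  note Kn = closed_normalD[OF K] and Hn = closed_normalD[OF H]
  let ?K = "G\<lparr>carrier := K\<rparr>" and ?H = "G\<lparr>carrier := H\<rparr>"
  interpret K: profinite_group ?K "subtopology T K" using closed_subgroup_profinite Kn by blast
  interpret H: profinite_group ?H "subtopology T H" using closed_subgroup_profinite Hn by blast
  obtain f where f: "f \<in> iso ?K ?H" "homeomorphic_map (subtopology T K) (subtopology T H) f"
    using iso by (auto simp: topgroup_iso_def)
  interpret f: topological_group_iso ?K "subtopology T K" ?H "subtopology T H" f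
    by unfold_locales (rule f)+
  have fK: "f ` K = H" using f.f_image by simp
  have cl: "T closure_of derived G L = subtopology T L closure_of derived G L"
    if L: "closed_normal G T L" for L
    using closed_derived_closed_normal(2)[OF L] closed_normalD[OF L] derived_incl[of L L]
    by (auto simp: closure_of_subtopology closed_derived_def Int_absorb1)
  have dK: "derived ?K K = derived G K" and dH: "derived ?H H = derived G H"
    using derived_consistent Kn(2) Hn(2) by blast+
  have "f ` derived G K = derived G H"
    using f.f.derived_img[of K] fK dK dH by simp
  then have D: "f ` closed_derived G T K = closed_derived G T H"
    using homeomorphic_map_closure_of[OF f(2), of "derived G K"] derived_incl[OF subset_refl Kn(2)] Kn(4)
    by (simp add: closed_derived_def cl[OF K] cl[OF H] topspace_eq)
  let ?D = "closed_derived G T K" and ?E = "closed_derived G T H"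
  note Dn = closed_derived_closed_normal[OF K] and En = closed_derived_closed_normal[OF H]
  have Ds: "subgroup ?D ?K" using subgroup_incl closed_normalD(2)[OF Dn(1)] Kn(2) Dn(2) by blast
  have DS: "?K\<lparr>carrier := ?D\<rparr> = G\<lparr>carrier := ?D\<rparr>" "subtopology (subtopology T K) ?D = subtopology T ?D"
    "?H\<lparr>carrier := ?E\<rparr> = G\<lparr>carrier := ?E\<rparr>" "subtopology (subtopology T H) ?E = subtopology T ?E"
    using Dn(2) En(2) by (simp_all add: subtopology_subtopology Int_absorb1)
  have "topological_group (G\<lparr>carrier := ?D\<rparr>) (subtopology T ?D)"
    "topological_group (G\<lparr>carrier := ?E\<rparr>) (subtopology T ?E)"
    using closed_subgroup_profinite closed_normalD[OF Dn(1)] closed_normalD[OF En(1)]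
    by (auto simp: profinite_group_def)
  then have "topological_group_iso (G\<lparr>carrier := ?D\<rparr>) (subtopology T ?D)
      (G\<lparr>carrier := ?E\<rparr>) (subtopology T ?E) f"
    using f.restrict[OF Ds] unfolding D DS by blast
  then have F: "f ` normal_Frattini_of G T ?D = normal_Frattini_of G T ?E"
    by (rule topological_group_iso.image_normal_Frattini)
  have "normal_Frattini_of G T ?D \<lhd> ?K" "normal_Frattini_of G T ?E \<lhd> ?H"
    using closed_normal_in_closed_normal derived_Frattini_closed_normal K H by blast+
  then show ?thesis
    using f.quotient_iso unfolding derived_Frattini_quotient_def F[symmetric] by blast
qed

end

context just_infinite_profinite_group
begin

text \<open>For these \<open>K\<close>, the sections given by \<open>K\<close> and the normal Frattini subgroup of \<open>K'\<close> are all
  isomorphic to one group \<open>Q\<close>. It is finite, and it is non-abelian because \<open>H'\<close> is non-trivial and so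
  differs from its normal Frattini subgroup. A single isomorphism class has only finitely many
  sections.\<close>
theorem finite_derived_Frattini_quotients:
  assumes nva: "\<not> virtually_abelian G T" and H: "open_normal G T H"
  shows "finite {K. closed_normal G T K \<and>
    derived_Frattini_quotient G T K \<cong> derived_Frattini_quotient G T H}"
proof -
  have Hcn: "closed_normal G T H" using open_normal_imp_closed_normal[OF H] .
  note Hn = closed_normalD[OF Hcn]
  let ?D = "closed_derived G T H"
  note Dn = closed_derived_closed_normal[OF Hcn]
  define P where "P = normal_Frattini_of G T ?D"
  define Q where "Q = G\<lparr>carrier := H\<rparr> Mod P"
  note Pn = derived_Frattini_closed_normal[OF Hcn, folded P_def]
  have "?D \<noteq> {\<one>}"
  proof
    assume "?D = {\<one>}"
    then have d: "derived G H \<subseteq> {\<one>}" using derived_subset_closed_derived[OF Hn(4)] by simp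
    interpret HG: group "G\<lparr>carrier := H\<rparr>" using subgroup_imp_group[OF Hn(2)] .
    have "x \<otimes> y = y \<otimes> x" if xy: "x \<in> H" "y \<in> H" for x y
    proof -
      have c: "x \<in> carrier G" "y \<in> carrier G" using xy Hn(4) by auto
      have "x \<otimes> y \<otimes> inv x \<otimes> inv y \<in> derived G H"
        unfolding derived_def using xy by (intro generate.incl) blast
      then have "x \<otimes> y \<otimes> inv x \<otimes> inv y = \<one>" using d by blast
      then have "(x \<otimes> y) \<otimes> inv (y \<otimes> x) = \<one>" using c by (simp add: inv_mult_group m_assoc)
      then show ?thesis using c inv_equality[of "x \<otimes> y" "inv (y \<otimes> x)"] by (simp add: inv_solve_right')
    qed
    then have "comm_group (G\<lparr>carrier := H\<rparr>)" by (intro HG.group_comm_groupI) simp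
    moreover have "finite (rcosets H)" using open_subgroup_finite_index Hn(2) H by (simp add: open_normal_def)
    ultimately show False using nva Hn by (auto simp: virtually_abelian_def)
  qed
  then have Pne: "P \<noteq> {\<one>}" and PD: "P \<subset> ?D"
    using normal_Frattini_of_nontrivial normal_Frattini_of_psubset Dn by (auto simp: P_def)
  have PH: "P \<lhd> G\<lparr>carrier := H\<rparr>" using closed_normal_in_closed_normal[OF Hcn Pn] .
  have Qgrp: "group Q" unfolding Q_def using normal.factorgroup_is_group[OF PH] .
  have Qnc: "\<not> comm_group Q"
  proof
    assume "comm_group Q"
    then have "derived G H \<subseteq> P" using derived_of_subgroup_minimal[OF PH Hn(2)] by (simp add: Q_def)
    then have "?D \<subseteq> P"
      unfolding closed_derived_def using closure_of_minimal closed_normalD(3)[OF Pn(1)] by blast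
    then show False using PD by blast
  qed
  have "finite (carrier Q)"
  proof -
    interpret HP: profinite_group "G\<lparr>carrier := H\<rparr>" "subtopology T H"
      using closed_subgroup_profinite Hn by blast
    have "openin T P" using open_normal_if_nontrivial[OF Pn(1) Pne] by (simp add: open_normal_def)
    then have "openin (subtopology T H) P" using Pn(2) by (auto simp: openin_subtopology)
    then show ?thesis
      using HP.open_subgroup_finite_index[OF normal_imp_subgroup[OF PH]] by (simp add: Q_def FactGroup_def)
  qed
  define \<F> where "\<F> = {X :: nat monoid. group X \<and> Q \<cong> X}"
  have F: "finite_group_class \<F>"
    using iso_finite[of Q] \<open>finite (carrier Q)\<close> iso_trans[of Q]
    by (auto simp: finite_group_class_def \<F>_def)
  have Fnc: "\<forall>X\<in>\<F>. \<not> comm_group X"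
  proof
    fix X assume X: "X \<in> \<F>"
    show "\<not> comm_group X"
    proof
      assume "comm_group X"
      then have "comm_group Q"
        using comm_group.iso_imp_comm_group[of X Q] group.iso_sym[OF Qgrp, of X] X Qgrp
        by (simp add: \<F>_def group_def)
      then show False using Qnc by simp
    qed
  qed
  have "X \<cong> Y" if "X \<in> \<F>" "Y \<in> \<F>" for X Y
    using that group.iso_sym[OF Qgrp, of X] iso_trans[of X Q Y] by (simp add: \<F>_def)
  then have "iso_classes \<F> \<subseteq> {\<F>}" by (auto simp: iso_classes_def quotient_def)
  then have "finite (iso_classes \<F>)" using finite_subset by blast
  then have fin: "finite (class_sections \<F> G T)" using class_sections_imp(2)[OF F Fnc] by blast
  obtain X :: "nat monoid" where X: "group X" "Q \<cong> X"
    using nat_copy_of_finite_group[OF Qgrp \<open>finite (carrier Q)\<close>] .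
  have "{K. closed_normal G T K \<and> derived_Frattini_quotient G T K \<cong> derived_Frattini_quotient G T H}
      \<subseteq> fst ` class_sections \<F> G T"
  proof safe
    fix K assume K: "closed_normal G T K"
      and iso: "derived_Frattini_quotient G T K \<cong> derived_Frattini_quotient G T H"
    have "derived_Frattini_quotient G T K \<cong> X"
      using iso_trans[OF iso] X(2) by (simp add: Q_def P_def derived_Frattini_quotient_def)
    then have "in_class (derived_Frattini_quotient G T K) \<F>"
      using X by (auto simp: in_class_def \<F>_def)
    then have "(K, normal_Frattini_of G T (closed_derived G T K)) \<in> class_sections \<F> G T"
      using K derived_Frattini_closed_normal[OF K]
      by (simp add: class_sections_def derived_Frattini_quotient_def)
    then show "K \<in> fst ` class_sections \<F> G T" by force
  qed
  then show ?thesis using fin finite_surj by blast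
qed

end

section \<open>Sections and normal subgroups of just infinite groups\<close>

theorem theoremD:
  fixes G :: "('a, 'b) monoid_scheme" and T :: "'a topology"
  assumes "profinite_group G T" and "just_infinite G T"
  shows
    "(\<forall>\<F>. finite_group_class \<F> \<and> (\<forall>F\<in>\<F>. \<not> comm_group F) \<and>
        infinite {(M, N). closed_normal G T M \<and> closed_normal G T N \<and> N \<subseteq> M \<and>
                          in_class (G\<lparr>carrier := M\<rparr> Mod N) \<F>} \<longrightarrow>
        (residually (between_Inn_Aut \<F>) G T \<or>
         (\<exists>H. open_normal G T H \<and> residually \<F> (G\<lparr>carrier := H\<rparr>) (subtopology T H))) \<and>
        (unbounded_height (between_Inn_Aut \<F>) \<or> unbounded_height \<F>) \<and>
        infinite (iso_classes \<F>)) \<and>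
     (\<not> virtually_abelian G T \<longrightarrow>
        (\<forall>H. open_normal G T H \<and> H \<noteq> carrier G \<longrightarrow>
          finite {K. closed_normal G T K \<and>
             topgroup_iso
               (derived_Frattini_quotient G T K) (derived_Frattini_quotient_topology G T K)
               (derived_Frattini_quotient G T H) (derived_Frattini_quotient_topology G T H)} \<and>
          finite {K. closed_normal G T K \<and>
             topgroup_iso (G\<lparr>carrier := K\<rparr>) (subtopology T K)
                          (G\<lparr>carrier := H\<rparr>) (subtopology T H)}))"
proof -
  interpret profinite_group G T by fact
  interpret just_infinite_profinite_group G T by unfold_locales fact
  show ?thesis
  proof (intro conjI allI impI)
    fix \<F> assume "finite_group_class \<F> \<and> (\<forall>F\<in>\<F>. \<not> comm_group F) \<and>
        infinite {(M, N). closed_normal G T M \<and> closed_normal G T N \<and> N \<subseteq> M \<and>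
                          in_class (G\<lparr>carrier := M\<rparr> Mod N) \<F>}"
    then have F: "finite_group_class \<F>" "\<forall>F\<in>\<F>. \<not> comm_group F" "infinite (class_sections \<F> G T)"
      by (auto simp: class_sections_def)
    show "residually (between_Inn_Aut \<F>) G T \<or>
         (\<exists>H. open_normal G T H \<and> residually \<F> (G\<lparr>carrier := H\<rparr>) (subtopology T H))"
      using residually_dichotomy[OF F] .
    show "unbounded_height (between_Inn_Aut \<F>) \<or> unbounded_height \<F>" "infinite (iso_classes \<F>)"
      using class_sections_imp[OF F] .
  next
    fix H assume "\<not> virtually_abelian G T" "open_normal G T H \<and> H \<noteq> carrier G"
    then have fin: "finite {K. closed_normal G T K \<and>
        derived_Frattini_quotient G T K \<cong> derived_Frattini_quotient G T H}" and H: "open_normal G T H"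
      using finite_derived_Frattini_quotients by auto
    show "finite {K. closed_normal G T K \<and>
             topgroup_iso
               (derived_Frattini_quotient G T K) (derived_Frattini_quotient_topology G T K)
               (derived_Frattini_quotient G T H) (derived_Frattini_quotient_topology G T H)}"
      by (rule finite_subset[OF _ fin]) (auto simp: topgroup_iso_def is_iso_def)
    show "finite {K. closed_normal G T K \<and>
             topgroup_iso (G\<lparr>carrier := K\<rparr>) (subtopology T K)
                          (G\<lparr>carrier := H\<rparr>) (subtopology T H)}"
      by (rule finite_subset[OF _ fin])
        (auto intro: derived_Frattini_quotient_iso open_normal_imp_closed_normal H)
  qed
qed

end
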